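(* Let $g\geq 1$, let $\mathcal{A}$ be a full subcategory of $\mathrm{Grph}_g$ with the diamond property, and let $\mathbb{V}$ be an $\mathcal{A}$-graph local system. Suppose that $G$ and $G'$ are $\mathcal{A}$-graphs (so graphs of genus $g$), and $e\in E(G)$ is an edge such that $G/e\cong G'$. Then there are injective group homomorphisms $$\mathrm{Aut}(G)\ \xleftarrow{\ i_e\ }\ \mathrm{stab}_{\mathrm{Aut}(G)}(e)\ \xrightarrow{\ h_e\ }\ \mathrm{Aut}(G'),$$ where $i_e$ is the inclusion and $h_e$ is the map induced by the contraction of $e$ and an isomorphism $G/e\cong G'$. Further assume that for every other $e'\in E(G)$, if $G/e'\cong G/e$ then there exists an automorphism $\varphi\in\mathrm{Aut}(G)$ such that $\varphi(e')=e$. (1) If $i_e$ is surjective, i.e. $\mathrm{stab}_{\mathrm{Aut}(G)}(e)=\mathrm{Aut}(G)$, then $d_{G'}^{G}$ is injective. (2) If $h_e$ is surjective and $\mathrm{stab}_{\mathrm{Aut}(G)}(e)$ is a normal subgroup of $\mathrm{Aut}(G)$, then $d_{G'}^{G}$ is surjective.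
   Context: $\mathrm{Grph}_g$ is the category of finite connected multigraphs (loops and parallel edges allowed) of genus (first Betti number) $g$, with morphisms generated by isomorphisms and contractions $G\to G/e$ of non-loop edges; graph isomorphisms are bijections on vertices and half-edges. A (small) full subcategory $\mathcal{A}$, closed under isomorphisms, has the diamond property if whenever $G$, $G/e$, $G/\{e,f\}$ are in $\mathcal{A}$ then $G/f\in\mathcal{A}$; its objects are called $\mathcal{A}$-graphs. An $\mathcal{A}$-graph local system is a functor $\mathbb{V}:\mathcal{A}^{\mathrm{op}}\to\mathrm{Vect}_{\mathbb{Q}}^{\cong}$ to rational vector spaces and linear isomorphisms; write $V_G=\mathbb{V}(G)$ and $V_\phi:V_{G'}\to V_G$ for $\phi:G\to G'$. For a finite set $E$, $\det(E)=\Lambda^{|E|}(\mathbb{Q}^E)$, contravariantly functorial for graph isomorphisms; $\mathrm{Aut}(G)$ acts on $V_G\otimes\det(E(G))$. The graph complex of $\mathbb{V}$ is, in degree $p$, $\bigoplus_{[G]:|E(G)|=p+1}(V_G\otimes\det(E(G)))^{\mathrm{Aut}(G)}$, over isomorphism classes of $\mathcal{A}$-graphs. For $\mathcal{A}$-graphs with $|E(G)|=|E(G')|+1$, the block $$d_{G'}^G:(V_{G'}\otimes\det(E(G')))^{\mathrm{Aut}(G')}\to(V_G\otimes\det(E(G)))^{\mathrm{Aut}(G)}$$ of its differential is $d_{G'}^G=\sum_e\overline{d}_e$, summed over edges $e\in E(G)$ with $G/e\cong G'$, where one chooses for each such $e$ a morphism $\phi_e:G\to G'$ factoring as $G\to G/e\xrightarrow{\overline{\phi}_e}G'$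 with $\overline{\phi}_e$ an isomorphism, and sets $\overline{d}_e=V_{\phi_e}\otimes(e\wedge\det\overline{\phi}_e)$; the result is independent of choices on $\mathrm{Aut}(G')$-invariants. $\mathrm{stab}_{\mathrm{Aut}(G)}(e)$ is the subgroup of automorphisms of $G$ mapping the edge $e$ to itself. *)

theory Defs
  imports Complex_Main "HOL-Library.Function_Algebras" "HOL-Algebra.Bij" "HOL-Algebra.Coset"
begin

section \<open>Multigraphs\<close>

text \<open>
  A multigraph consists of vertices, half-edges, the map attaching each half-edge to a vertex
  (\<open>root\<close>), and the fixed-point-free involution \<open>mate\<close> exchanging the two halves of each edge.
  An edge is the two-element set of its half-edges, so loops and parallel edges are allowed.
\<close>

record ('v, 'h) mgraph =
  verts :: "'v set"
  halves :: "'h set"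
  root :: "'h \<Rightarrow> 'v"
  mate :: "'h \<Rightarrow> 'h"

definition multigraph :: "('v, 'h) mgraph \<Rightarrow> bool" where
  "multigraph G \<longleftrightarrow> finite (verts G) \<and> finite (halves G) \<and>
     (\<forall>h\<in>halves G. root G h \<in> verts G \<and> mate G h \<in> halves G \<and>
        mate G h \<noteq> h \<and> mate G (mate G h) = h)"

definition edges :: "('v, 'h) mgraph \<Rightarrow> 'h set set" where
  "edges G = {{h, mate G h} | h. h \<in> halves G}"

definition nonloop_edges :: "('v, 'h) mgraph \<Rightarrow> 'h set set" where
  "nonloop_edges G = {{h, mate G h} | h. h \<in> halves G \<and> root G h \<noteq> root G (mate G h)}"

definition connected_graph :: "('v, 'h) mgraph \<Rightarrow> bool" where
  "connected_graph G \<longleftrightarrow> verts G \<noteq> {} \<and>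
     (\<forall>u\<in>verts G. \<forall>v\<in>verts G. (u, v) \<in> {(root G h, root G (mate G h)) | h. h \<in> halves G}\<^sup>*)"

text \<open>The first Betti number of a connected graph.\<close>

definition genus :: "('v, 'h) mgraph \<Rightarrow> int" where
  "genus G = int (card (edges G)) - int (card (verts G)) + 1"

definition Grph :: "nat \<Rightarrow> ('v, 'h) mgraph set" where
  "Grph g = {G. multigraph G \<and> connected_graph G \<and> genus G = int g}"


section \<open>The category of graphs of genus g\<close>

text \<open>
  The underlying map of a morphism is a map on cells (vertices and half-edges): a contraction
  sends both halves of the contracted edge to the vertex that the edge becomes.  Maps are
  extensional on the cells of their source, so that equality of functions is equality of
  morphisms.
\<close>

definition cells :: "('v, 'h) mgraph \<Rightarrow> ('v + 'h) set" where
  "cells G = Inl ` verts G \<union> Inr ` halves G"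

definition isos :: "('v, 'h) mgraph \<Rightarrow> ('v, 'h) mgraph \<Rightarrow> ('v + 'h \<Rightarrow> 'v + 'h) set" where
  "isos G G' = {f \<in> extensional (cells G).
     bij_betw f (Inl ` verts G) (Inl ` verts G') \<and>
     bij_betw f (Inr ` halves G) (Inr ` halves G') \<and>
     (\<forall>h\<in>halves G. \<exists>h'. f (Inr h) = Inr h' \<and>
        f (Inl (root G h)) = Inl (root G' h') \<and> f (Inr (mate G h)) = Inr (mate G' h'))}"

definition isomorphic :: "('v, 'h) mgraph \<Rightarrow> ('v, 'h) mgraph \<Rightarrow> bool" where
  "isomorphic G G' \<longleftrightarrow> isos G G' \<noteq> {}"

text \<open>
  The edge \<open>a\<close> is contracted onto one of its end vertices, picked by Hilbert choice; another
  choice gives a canonically isomorphic graph.  This keeps the vertex type of the graph.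
  These notions are used for non-loop edges only.
\<close>

definition merged_vertex :: "('v, 'h) mgraph \<Rightarrow> 'h set \<Rightarrow> 'v" where
  "merged_vertex G a = (SOME u. u \<in> root G ` a)"

definition merge :: "('v, 'h) mgraph \<Rightarrow> 'h set \<Rightarrow> 'v \<Rightarrow> 'v" where
  "merge G a v = (if v \<in> root G ` a then merged_vertex G a else v)"

definition contract :: "('v, 'h) mgraph \<Rightarrow> 'h set \<Rightarrow> ('v, 'h) mgraph" where
  "contract G a = \<lparr>verts = merge G a ` verts G, halves = halves G - a,
     root = merge G a \<circ> root G, mate = mate G\<rparr>"

definition contraction :: "('v, 'h) mgraph \<Rightarrow> 'h set \<Rightarrow> 'v + 'h \<Rightarrow> 'v + 'h" where
  "contraction G a = (\<lambda>x\<in>cells G. case x of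
       Inl v \<Rightarrow> Inl (merge G a v)
     | Inr h \<Rightarrow> if h \<in> a then Inl (merged_vertex G a) else Inr h)"

inductive morphism ::
    "nat \<Rightarrow> ('v, 'h) mgraph \<Rightarrow> ('v + 'h \<Rightarrow> 'v + 'h) \<Rightarrow> ('v, 'h) mgraph \<Rightarrow> bool" for g where
  iso: "G \<in> Grph g \<Longrightarrow> G' \<in> Grph g \<Longrightarrow> f \<in> isos G G' \<Longrightarrow> morphism g G f G'"
| contraction: "G \<in> Grph g \<Longrightarrow> a \<in> nonloop_edges G \<Longrightarrow>
    morphism g G (contraction G a) (contract G a)"
| comp: "morphism g G f G' \<Longrightarrow> morphism g G' f' G'' \<Longrightarrow>
    morphism g G (compose (cells G) f' f) G''"

text \<open>A full subcategory is determined by its set of objects.\<close>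

definition full_subcategory :: "nat \<Rightarrow> ('v, 'h) mgraph set \<Rightarrow> bool" where
  "full_subcategory g A \<longleftrightarrow> A \<subseteq> Grph g \<and>
     (\<forall>G\<in>A. \<forall>G'\<in>Grph g. isomorphic G G' \<longrightarrow> G' \<in> A)"

definition diamond_property :: "('v, 'h) mgraph set \<Rightarrow> bool" where
  "diamond_property A \<longleftrightarrow>
     (\<forall>G\<in>A. \<forall>a\<in>nonloop_edges G. \<forall>b\<in>nonloop_edges (contract G a).
        contract G a \<in> A \<longrightarrow> contract (contract G a) b \<in> A \<longrightarrow> contract G b \<in> A)"


section \<open>Automorphism groups\<close>

definition Aut :: "('v, 'h) mgraph \<Rightarrow> ('v + 'h \<Rightarrow> 'v + 'h) monoid" where
  "Aut G = (BijGroup (cells G))\<lparr>carrier := isos G G\<rparr>"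

definition edge_image :: "('v + 'h \<Rightarrow> 'v + 'h) \<Rightarrow> 'h set \<Rightarrow> 'h set" where
  "edge_image f a = Inr -` f ` Inr ` a"

definition stab :: "('v, 'h) mgraph \<Rightarrow> 'h set \<Rightarrow> ('v + 'h \<Rightarrow> 'v + 'h) set" where
  "stab G a = {\<psi> \<in> carrier (Aut G). edge_image \<psi> a = a}"

definition stab_group :: "('v, 'h) mgraph \<Rightarrow> 'h set \<Rightarrow> ('v + 'h \<Rightarrow> 'v + 'h) monoid" where
  "stab_group G a = (Aut G)\<lparr>carrier := stab G a\<rparr>"

text \<open>
  For an isomorphism \<open>\<theta>\<close> from \<open>G/a\<close> to \<open>G'\<close>, the automorphism of \<open>G'\<close> induced by \<open>\<psi>\<close> is the
  unique one that commutes with \<open>\<psi>\<close> along the composite of \<open>\<theta>\<close> with the contraction.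
\<close>

definition contract_along ::
    "('v, 'h) mgraph \<Rightarrow> 'h set \<Rightarrow> ('v + 'h \<Rightarrow> 'v + 'h) \<Rightarrow> 'v + 'h \<Rightarrow> 'v + 'h" where
  "contract_along G a \<theta> = compose (cells G) \<theta> (contraction G a)"

definition induced_aut :: "('v, 'h) mgraph \<Rightarrow> ('v, 'h) mgraph \<Rightarrow> 'h set \<Rightarrow>
    ('v + 'h \<Rightarrow> 'v + 'h) \<Rightarrow> ('v + 'h \<Rightarrow> 'v + 'h) \<Rightarrow> 'v + 'h \<Rightarrow> 'v + 'h" where
  "induced_aut G G' a \<theta> \<psi> = (THE \<eta>. \<eta> \<in> carrier (Aut G') \<and>
     compose (cells G) \<eta> (contract_along G a \<theta>) = compose (cells G) (contract_along G a \<theta>) \<psi>)"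


section \<open>Tensor products and exterior powers over the rationals\<close>

text \<open>
  A rational vector space is a subspace of a type carrying a scaling by rationals.
\<close>

definition linear_on ::
    "(rat \<Rightarrow> 'x::ab_group_add \<Rightarrow> 'x) \<Rightarrow> (rat \<Rightarrow> 'y::ab_group_add \<Rightarrow> 'y) \<Rightarrow> 'x set \<Rightarrow> ('x \<Rightarrow> 'y) \<Rightarrow> bool"
where
  "linear_on s t V f \<longleftrightarrow> (\<forall>x\<in>V. \<forall>y\<in>V. f (x + y) = f x + f y) \<and> (\<forall>c. \<forall>x\<in>V. f (s c x) = t c (f x))"

definition pscale :: "rat \<Rightarrow> ('x \<Rightarrow> rat) \<Rightarrow> 'x \<Rightarrow> rat" where
  "pscale c f = (\<lambda>x. c * f x)"

text \<open>
  Over a field, \<open>V \<otimes> W\<close> embeds into the dual of the space of bilinear forms on \<open>V \<times> W\<close>, with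
  \<open>v \<otimes> w\<close> acting as evaluation at \<open>(v, w)\<close>; it is the span of these evaluations.  The functionals
  are zero off the set of bilinear forms, which makes them extensional.
\<close>

definition bilinear_forms ::
    "(rat \<Rightarrow> 'x::ab_group_add \<Rightarrow> 'x) \<Rightarrow> 'x set \<Rightarrow> (rat \<Rightarrow> 'y::ab_group_add \<Rightarrow> 'y) \<Rightarrow> 'y set \<Rightarrow>
     ('x \<Rightarrow> 'y \<Rightarrow> rat) set" where
  "bilinear_forms s V t W =
     {\<beta>. (\<forall>v\<in>V. linear_on t (*) W (\<beta> v)) \<and> (\<forall>w\<in>W. linear_on s (*) V (\<lambda>v. \<beta> v w))}"

definition elementary_tensor ::
    "(rat \<Rightarrow> 'x::ab_group_add \<Rightarrow> 'x) \<Rightarrow> 'x set \<Rightarrow> (rat \<Rightarrow> 'y::ab_group_add \<Rightarrow> 'y) \<Rightarrow> 'y set \<Rightarrow>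
     'x \<Rightarrow> 'y \<Rightarrow> ('x \<Rightarrow> 'y \<Rightarrow> rat) \<Rightarrow> rat" where
  "elementary_tensor s V t W v w = (\<lambda>\<beta>. if \<beta> \<in> bilinear_forms s V t W then \<beta> v w else 0)"

definition tensor_space ::
    "(rat \<Rightarrow> 'x::ab_group_add \<Rightarrow> 'x) \<Rightarrow> 'x set \<Rightarrow> (rat \<Rightarrow> 'y::ab_group_add \<Rightarrow> 'y) \<Rightarrow> 'y set \<Rightarrow>
     (('x \<Rightarrow> 'y \<Rightarrow> rat) \<Rightarrow> rat) set" where
  "tensor_space s V t W =
     module.span pscale {elementary_tensor s V t W v w | v w. v \<in> V \<and> w \<in> W}"

text \<open>
  The map \<open>p \<otimes> q\<close> into \<open>V \<otimes> W\<close>, for linear maps \<open>p\<close> and \<open>q\<close> into \<open>V\<close> and \<open>W\<close>; it sends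
  \<open>v' \<otimes> w'\<close> to \<open>p v' \<otimes> q w'\<close>.
\<close>

definition tensor_map ::
    "(rat \<Rightarrow> 'x::ab_group_add \<Rightarrow> 'x) \<Rightarrow> 'x set \<Rightarrow> (rat \<Rightarrow> 'y::ab_group_add \<Rightarrow> 'y) \<Rightarrow> 'y set \<Rightarrow>
     ('x1 \<Rightarrow> 'x) \<Rightarrow> ('y1 \<Rightarrow> 'y) \<Rightarrow> (('x1 \<Rightarrow> 'y1 \<Rightarrow> rat) \<Rightarrow> rat) \<Rightarrow> ('x \<Rightarrow> 'y \<Rightarrow> rat) \<Rightarrow> rat" where
  "tensor_map s V t W p q T =
     (\<lambda>\<beta>. if \<beta> \<in> bilinear_forms s V t W then T (\<lambda>v w. \<beta> (p v) (q w)) else 0)"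

text \<open>
  Likewise the \<open>k\<close>-th exterior power of \<open>W\<close> is the span, in the dual of the space of alternating
  \<open>k\<close>-linear forms on \<open>W\<close>, of the evaluations at \<open>k\<close>-tuples of elements of \<open>W\<close>.
\<close>

definition alternating_forms ::
    "(rat \<Rightarrow> 'y::ab_group_add \<Rightarrow> 'y) \<Rightarrow> nat \<Rightarrow> 'y set \<Rightarrow> ('y list \<Rightarrow> rat) set" where
  "alternating_forms t k W = {\<alpha>. \<forall>ws\<in>lists W. length ws = k \<longrightarrow>
     (\<forall>i<k. linear_on t (*) W (\<lambda>w. \<alpha> (ws[i := w]))) \<and> (\<not> distinct ws \<longrightarrow> \<alpha> ws = 0)}"

definition wedge ::
    "(rat \<Rightarrow> 'y::ab_group_add \<Rightarrow> 'y) \<Rightarrow> 'y set \<Rightarrow> 'y list \<Rightarrow> ('y list \<Rightarrow> rat) \<Rightarrow> rat" where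
  "wedge t W ws = (\<lambda>\<alpha>. if \<alpha> \<in> alternating_forms t (length ws) W then \<alpha> ws else 0)"

definition exterior_power ::
    "(rat \<Rightarrow> 'y::ab_group_add \<Rightarrow> 'y) \<Rightarrow> nat \<Rightarrow> 'y set \<Rightarrow> (('y list \<Rightarrow> rat) \<Rightarrow> rat) set" where
  "exterior_power t k W = module.span pscale {wedge t W ws | ws. ws \<in> lists W \<and> length ws = k}"

text \<open>
  The map on \<open>k\<close>-th exterior powers induced by a linear map \<open>p\<close> into \<open>W\<close>, and left
  multiplication by \<open>x \<in> W\<close> from the \<open>k\<close>-th exterior power of a subspace of \<open>W\<close> to the
  \<open>(k + 1)\<close>-st exterior power of \<open>W\<close>.
\<close>

definition exterior_map ::
    "(rat \<Rightarrow> 'y::ab_group_add \<Rightarrow> 'y) \<Rightarrow> nat \<Rightarrow> 'y set \<Rightarrow> ('y1 \<Rightarrow> 'y) \<Rightarrow>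
     (('y1 list \<Rightarrow> rat) \<Rightarrow> rat) \<Rightarrow> ('y list \<Rightarrow> rat) \<Rightarrow> rat" where
  "exterior_map t k W p \<omega> =
     (\<lambda>\<alpha>. if \<alpha> \<in> alternating_forms t k W then \<omega> (\<lambda>ws. \<alpha> (map p ws)) else 0)"

definition wedge_left ::
    "(rat \<Rightarrow> 'y::ab_group_add \<Rightarrow> 'y) \<Rightarrow> nat \<Rightarrow> 'y set \<Rightarrow> 'y \<Rightarrow>
     (('y list \<Rightarrow> rat) \<Rightarrow> rat) \<Rightarrow> ('y list \<Rightarrow> rat) \<Rightarrow> rat" where
  "wedge_left t k W x \<omega> =
     (\<lambda>\<alpha>. if \<alpha> \<in> alternating_forms t (Suc k) W then \<omega> (\<lambda>ws. \<alpha> (x # ws)) else 0)"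


section \<open>Determinants of edge sets\<close>

definition coord_space :: "'e set \<Rightarrow> ('e \<Rightarrow> rat) set" where
  "coord_space E = {w. \<forall>x. x \<notin> E \<longrightarrow> w x = 0}"

definition unit_vec :: "'e \<Rightarrow> 'e \<Rightarrow> rat" where
  "unit_vec a = (\<lambda>x. if x = a then 1 else 0)"

type_synonym 'e det = "(('e \<Rightarrow> rat) list \<Rightarrow> rat) \<Rightarrow> rat"

definition det_space :: "'e set \<Rightarrow> 'e det set" where
  "det_space E = exterior_power pscale (card E) (coord_space E)"

text \<open>
  An isomorphism from \<open>G\<close> to \<open>G'\<close> maps \<open>det (E G')\<close> to \<open>det (E G)\<close>, by the linear map which sends
  each basis vector of \<open>\<rat>\<^sup>E\<^sup>'\<close> to the basis vector of the corresponding edge of \<open>G\<close>.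
\<close>

definition det_map :: "('v, 'h) mgraph \<Rightarrow> ('v + 'h \<Rightarrow> 'v + 'h) \<Rightarrow> 'h set det \<Rightarrow> 'h set det" where
  "det_map G f = exterior_map pscale (card (edges G)) (coord_space (edges G))
     (\<lambda>w a. if a \<in> edges G then w (edge_image f a) else 0)"

text \<open>The map \<open>\<omega> \<mapsto> a \<and> \<omega>\<close> from \<open>det (E (G/a))\<close> to \<open>det (E G)\<close>; note \<open>E (G/a) = E G - {a}\<close>.\<close>

definition edge_wedge :: "('v, 'h) mgraph \<Rightarrow> 'h set \<Rightarrow> 'h set det \<Rightarrow> 'h set det" where
  "edge_wedge G a = wedge_left pscale (card (edges (contract G a))) (coord_space (edges G)) (unit_vec a)"


section \<open>Local systems and the differential of the graph complex\<close>

text \<open>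
  \<open>V G\<close> is the value at the object \<open>G\<close>, and \<open>VM G G' f\<close> maps \<open>V G'\<close> to \<open>V G\<close> for a morphism \<open>f\<close>
  from \<open>G\<close> to \<open>G'\<close>.
\<close>

locale graph_local_system = vector_space scale
  for scale :: "rat \<Rightarrow> 'w::ab_group_add \<Rightarrow> 'w" +
  fixes g :: nat and A :: "('v, 'h) mgraph set"
    and V :: "('v, 'h) mgraph \<Rightarrow> 'w set"
    and VM :: "('v, 'h) mgraph \<Rightarrow> ('v, 'h) mgraph \<Rightarrow> ('v + 'h \<Rightarrow> 'v + 'h) \<Rightarrow> 'w \<Rightarrow> 'w"
  assumes subspace_V: "G \<in> A \<Longrightarrow> subspace (V G)"
    and linear_VM: "G \<in> A \<Longrightarrow> G' \<in> A \<Longrightarrow> morphism g G f G' \<Longrightarrow>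
      linear_on scale scale (V G') (VM G G' f)"
    and bij_VM: "G \<in> A \<Longrightarrow> G' \<in> A \<Longrightarrow> morphism g G f G' \<Longrightarrow> bij_betw (VM G G' f) (V G') (V G)"
    and VM_id: "G \<in> A \<Longrightarrow> x \<in> V G \<Longrightarrow> VM G G (\<lambda>c\<in>cells G. c) x = x"
    and VM_comp: "G \<in> A \<Longrightarrow> G' \<in> A \<Longrightarrow> G'' \<in> A \<Longrightarrow> morphism g G f G' \<Longrightarrow> morphism g G' f' G'' \<Longrightarrow>
      x \<in> V G'' \<Longrightarrow> VM G G'' (compose (cells G) f' f) x = VM G G' f (VM G' G'' f' x)"

definition twisted :: "(rat \<Rightarrow> 'w::ab_group_add \<Rightarrow> 'w) \<Rightarrow> (('v, 'h) mgraph \<Rightarrow> 'w set) \<Rightarrow>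
    ('v, 'h) mgraph \<Rightarrow> (('w \<Rightarrow> 'h set det \<Rightarrow> rat) \<Rightarrow> rat) set" where
  "twisted scale V G = tensor_space scale (V G) pscale (det_space (edges G))"

definition invariants :: "(rat \<Rightarrow> 'w::ab_group_add \<Rightarrow> 'w) \<Rightarrow> (('v, 'h) mgraph \<Rightarrow> 'w set) \<Rightarrow>
    (('v, 'h) mgraph \<Rightarrow> ('v, 'h) mgraph \<Rightarrow> ('v + 'h \<Rightarrow> 'v + 'h) \<Rightarrow> 'w \<Rightarrow> 'w) \<Rightarrow>
    ('v, 'h) mgraph \<Rightarrow> (('w \<Rightarrow> 'h set det \<Rightarrow> rat) \<Rightarrow> rat) set" where
  "invariants scale V VM G = {x \<in> twisted scale V G. \<forall>\<psi>\<in>carrier (Aut G).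
     tensor_map scale (V G) pscale (det_space (edges G)) (VM G G \<psi>) (det_map G \<psi>) x = x}"

definition contracting_edges :: "('v, 'h) mgraph \<Rightarrow> ('v, 'h) mgraph \<Rightarrow> 'h set set" where
  "contracting_edges G G' = {a \<in> nonloop_edges G. isomorphic (contract G a) G'}"

text \<open>
  The summand of the differential at the edge \<open>a\<close>, for a chosen isomorphism \<open>f\<close> from \<open>G/a\<close>
  to \<open>G'\<close>, and the block from \<open>G'\<close> to \<open>G\<close> of the differential, for a choice \<open>\<phi> a\<close> of such
  isomorphisms for all edges \<open>a\<close> with \<open>G/a \<cong> G'\<close>.
\<close>

definition edge_diff :: "(rat \<Rightarrow> 'w::ab_group_add \<Rightarrow> 'w) \<Rightarrow> (('v, 'h) mgraph \<Rightarrow> 'w set) \<Rightarrow>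
    (('v, 'h) mgraph \<Rightarrow> ('v, 'h) mgraph \<Rightarrow> ('v + 'h \<Rightarrow> 'v + 'h) \<Rightarrow> 'w \<Rightarrow> 'w) \<Rightarrow>
    ('v, 'h) mgraph \<Rightarrow> ('v, 'h) mgraph \<Rightarrow> 'h set \<Rightarrow> ('v + 'h \<Rightarrow> 'v + 'h) \<Rightarrow>
    (('w \<Rightarrow> 'h set det \<Rightarrow> rat) \<Rightarrow> rat) \<Rightarrow> ('w \<Rightarrow> 'h set det \<Rightarrow> rat) \<Rightarrow> rat" where
  "edge_diff scale V VM G G' a f =
     tensor_map scale (V G) pscale (det_space (edges G))
       (VM G G' (contract_along G a f)) (edge_wedge G a \<circ> det_map (contract G a) f)"

definition block_diff :: "(rat \<Rightarrow> 'w::ab_group_add \<Rightarrow> 'w) \<Rightarrow> (('v, 'h) mgraph \<Rightarrow> 'w set) \<Rightarrow>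
    (('v, 'h) mgraph \<Rightarrow> ('v, 'h) mgraph \<Rightarrow> ('v + 'h \<Rightarrow> 'v + 'h) \<Rightarrow> 'w \<Rightarrow> 'w) \<Rightarrow>
    ('v, 'h) mgraph \<Rightarrow> ('v, 'h) mgraph \<Rightarrow> ('h set \<Rightarrow> 'v + 'h \<Rightarrow> 'v + 'h) \<Rightarrow>
    (('w \<Rightarrow> 'h set det \<Rightarrow> rat) \<Rightarrow> rat) \<Rightarrow> ('w \<Rightarrow> 'h set det \<Rightarrow> rat) \<Rightarrow> rat" where
  "block_diff scale V VM G G' \<phi> x =
     (\<Sum>a\<in>contracting_edges G G'. edge_diff scale V VM G G' a (\<phi> a) x)"

end

theory Submission
  imports Defs "HOL-Combinatorics.Permutations"
begin

text \<open>
  For a contracting edge \<open>a\<close> of \<open>G\<close> and an isomorphism \<open>f\<close> from \<open>G/a\<close> to \<open>G'\<close>, let \<open>P\<^sub>a\<close> be the composite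
  \<open>G \<rightarrow> G/a \<rightarrow> G'\<close> and \<open>T\<^sub>a\<close> the summand \<open>V(P\<^sub>a) \<otimes> (a \<and> det f)\<close> of the differential, and write \<open>\<psi>\<^sup>*\<close> for
  the action of an automorphism \<open>\<psi>\<close> on twisted spaces.  Two facts carry the proof.

  Each \<open>T\<^sub>a\<close> is a bijection between the full twisted spaces, before passing to invariants
  (\<open>bij_betw_edge_diff\<close>): \<open>V(P\<^sub>a)\<close> is an isomorphism, and so is wedging with \<open>a\<close>, because determinants are
  lines generated by the wedge of the standard basis.

  The summands are equivariant (\<open>edge_diff_equivariant\<close>): if \<open>\<eta> \<circ> P\<^sub>a = P\<^sub>b \<circ> \<psi>\<close> for automorphisms \<open>\<psi>\<close> of \<open>G\<close>
  and \<open>\<eta>\<close> of \<open>G'\<close> with \<open>b = \<psi>(a)\<close>, then \<open>\<psi>\<^sup>* T\<^sub>b = T\<^sub>a \<eta>\<^sup>*\<close>.  For given \<open>\<psi>\<close> such an \<open>\<eta>\<close> always exists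
  (\<open>contract_along_compare\<close>), and for \<open>\<psi>\<close> fixing \<open>e\<close> it is the induced automorphism.  On invariants of
  \<open>G'\<close> the action of \<open>\<eta>\<close> disappears.

  The assumption on \<open>e\<close> says that the contracting edges form the orbit of \<open>e\<close>.  If all automorphisms fix
  \<open>e\<close>, the block is the single summand \<open>T\<^sub>e\<close>, which is injective.  For surjectivity, let \<open>y\<close> be invariant
  and \<open>y = T\<^sub>e x\<close>.  Every automorphism \<open>\<eta>\<close> of \<open>G'\<close> is induced by some \<open>\<psi>\<close> fixing \<open>e\<close>, so that
  \<open>T\<^sub>e \<eta>\<^sup>* x = \<psi>\<^sup>* y = y = T\<^sub>e x\<close>, and \<open>x\<close> is invariant because \<open>T\<^sub>e\<close> is injective.  By equivariance each summand
  of the differential takes \<open>x\<close> to \<open>y\<close>, so \<open>x\<close> goes to \<open>n y\<close>, where \<open>n\<close> is the number of contracting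
  edges, and \<open>n\<close> is invertible in the rationals.

  The positive genus enters in the injectivity of the map on stabilizers: the graph with two vertices and
  one edge has an automorphism that swaps the ends of the edge and becomes trivial after contraction.
\<close>

section \<open>Functorial maps on tensor products\<close>

interpretation pscale: vector_space "pscale :: rat \<Rightarrow> ('x \<Rightarrow> rat) \<Rightarrow> 'x \<Rightarrow> rat"
  by unfold_locales (auto simp: pscale_def fun_eq_iff algebra_simps)

interpretation pscale: module_pair "pscale :: rat \<Rightarrow> ('x \<Rightarrow> rat) \<Rightarrow> 'x \<Rightarrow> rat"
  "pscale :: rat \<Rightarrow> ('y \<Rightarrow> rat) \<Rightarrow> 'y \<Rightarrow> rat"
  by unfold_locales

lemma module_hom_pscaleI:
  assumes "\<And>x y. f (x + y) = f x + f y" and "\<And>c x. f (pscale c x) = pscale c (f x)"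
  shows "module_hom pscale pscale f"
  using assms by unfold_locales auto

lemma module_hom_tensor_map: "module_hom pscale pscale (tensor_map s V t W p q)"
  by (rule module_hom_pscaleI) (auto simp: tensor_map_def pscale_def fun_eq_iff)

lemma module_hom_exterior_map: "module_hom pscale pscale (exterior_map t k W p)"
  by (rule module_hom_pscaleI) (auto simp: exterior_map_def pscale_def fun_eq_iff)

lemma module_hom_wedge_left: "module_hom pscale pscale (wedge_left t k W x)"
  by (rule module_hom_pscaleI) (auto simp: wedge_left_def pscale_def fun_eq_iff)

lemma module_hom_imp_linear_on: "module_hom s t f \<Longrightarrow> linear_on s t W f"
  by (simp add: linear_on_def module_hom.add module_hom.scale)

lemma linear_onD:
  assumes "linear_on s t V f"
  shows "x \<in> V \<Longrightarrow> y \<in> V \<Longrightarrow> f (x + y) = f x + f y" and "x \<in> V \<Longrightarrow> f (s c x) = t c (f x)"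
  using assms by (auto simp: linear_on_def)

lemma linear_on_compose:
  assumes "linear_on s t V p" and "p \<in> V \<rightarrow> W" and "linear_on t r W q"
  shows "linear_on s r V (q \<circ> p)"
  using assms unfolding linear_on_def by (auto simp: Pi_iff)

lemma linear_on_inv_into:
  assumes "module.subspace s V" and "module s" and "linear_on s t V p" and "bij_betw p V W"
  shows "linear_on t s W (inv_into V p)"
proof -
  interpret module s by fact
  note sub = subspace_add[OF assms(1)] subspace_scale[OF assms(1)]
  have W: "W = p ` V" and inj: "inj_on p V"
    using assms(4) by (auto simp: bij_betw_def)
  show ?thesis
    unfolding linear_on_def W using inj sub
    by (auto simp flip: linear_onD[OF assms(3)])
qed

lemma bilinear_forms_pullback:
  assumes "linear_on s' s V' p" and "p \<in> V' \<rightarrow> V" and "linear_on t' t W' q" and "q \<in> W' \<rightarrow> W"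
    and "\<beta> \<in> bilinear_forms s V t W"
  shows "(\<lambda>v w. \<beta> (p v) (q w)) \<in> bilinear_forms s' V' t' W'"
  using assms unfolding bilinear_forms_def linear_on_def by (auto simp: Pi_iff)

lemma tensor_map_elementary:
  assumes "linear_on s' s V' p" and "p \<in> V' \<rightarrow> V" and "linear_on t' t W' q" and "q \<in> W' \<rightarrow> W"
  shows "tensor_map s V t W p q (elementary_tensor s' V' t' W' v w) =
    elementary_tensor s V t W (p v) (q w)"
  using bilinear_forms_pullback[OF assms]
  by (auto simp: tensor_map_def elementary_tensor_def fun_eq_iff)

lemma tensor_map_in_space:
  assumes "linear_on s' s V' p" and "p \<in> V' \<rightarrow> V" and "linear_on t' t W' q" and "q \<in> W' \<rightarrow> W"
    and "x \<in> tensor_space s' V' t' W'"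
  shows "tensor_map s V t W p q x \<in> tensor_space s V t W"
proof -
  interpret module_hom pscale pscale "tensor_map s V t W p q"
    by (rule module_hom_tensor_map)
  have "tensor_map s V t W p q x \<in>
      tensor_map s V t W p q ` pscale.span {elementary_tensor s' V' t' W' v w | v w. v \<in> V' \<and> w \<in> W'}"
    using assms(5) by (simp add: tensor_space_def)
  also have "\<dots> \<subseteq> tensor_space s V t W"
    unfolding span_image[symmetric] tensor_space_def using assms(2,4)
    by (intro pscale.span_mono) (auto simp: tensor_map_elementary[OF assms(1-4)] Pi_iff, blast)
  finally show ?thesis .
qed

text \<open>Linear maps on a tensor product are compared on elementary tensors, so that identities between
  maps of the form \<open>p \<otimes> q\<close> reduce to identities of \<open>p\<close> on \<open>V'\<close> and of \<open>q\<close> on \<open>W'\<close>.\<close>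

lemma tensor_map_cong:
  assumes "linear_on s' s V' p" and "p \<in> V' \<rightarrow> V" and "linear_on t' t W' q" and "q \<in> W' \<rightarrow> W"
    and "\<And>v. v \<in> V' \<Longrightarrow> p' v = p v" and "\<And>w. w \<in> W' \<Longrightarrow> q' w = q w"
    and sub: "module.subspace s' V'" "module s'" "module.subspace t' W'" "module t'"
    and x: "x \<in> tensor_space s' V' t' W'"
  shows "tensor_map s V t W p' q' x = tensor_map s V t W p q x"
proof (rule pscale.module_hom_eq_on_span[OF module_hom_tensor_map module_hom_tensor_map _
      x[unfolded tensor_space_def]])
  interpret s': module s' by fact
  interpret t': module t' by fact
  note 1 = s'.subspace_add[OF sub(1)] s'.subspace_scale[OF sub(1)]
    t'.subspace_add[OF sub(3)] t'.subspace_scale[OF sub(3)]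
  have "linear_on s' s V' p'" "linear_on t' t W' q'" "p' \<in> V' \<rightarrow> V" "q' \<in> W' \<rightarrow> W"
    using assms(1-6) 1 by (auto simp: linear_on_def Pi_iff)
  then show "tensor_map s V t W p' q' y = tensor_map s V t W p q y"
    if "y \<in> {elementary_tensor s' V' t' W' v w | v w. v \<in> V' \<and> w \<in> W'}" for y
    using that assms(1-6) by (auto simp: tensor_map_elementary)
qed

lemma tensor_map_compose:
  assumes "linear_on s1 s2 V1 p1" and "p1 \<in> V1 \<rightarrow> V2" and "linear_on t1 t2 W1 q1" and "q1 \<in> W1 \<rightarrow> W2"
    and "linear_on s2 s3 V2 p2" and "p2 \<in> V2 \<rightarrow> V3" and "linear_on t2 t3 W2 q2" and "q2 \<in> W2 \<rightarrow> W3"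
    and x: "x \<in> tensor_space s1 V1 t1 W1"
  shows "tensor_map s3 V3 t3 W3 p2 q2 (tensor_map s2 V2 t2 W2 p1 q1 x) =
    tensor_map s3 V3 t3 W3 (p2 \<circ> p1) (q2 \<circ> q1) x"
proof -
  have "(tensor_map s3 V3 t3 W3 p2 q2 \<circ> tensor_map s2 V2 t2 W2 p1 q1) x =
      tensor_map s3 V3 t3 W3 (p2 \<circ> p1) (q2 \<circ> q1) x"
  proof (rule pscale.module_hom_eq_on_span[OF _ module_hom_tensor_map _
        x[unfolded tensor_space_def]])
    show "module_hom pscale pscale (tensor_map s3 V3 t3 W3 p2 q2 \<circ> tensor_map s2 V2 t2 W2 p1 q1)"
      by (rule module_hom_compose[OF module_hom_tensor_map module_hom_tensor_map])
    have "p2 \<circ> p1 \<in> V1 \<rightarrow> V3" "q2 \<circ> q1 \<in> W1 \<rightarrow> W3"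
      using assms(2,4,6,8) by auto
    with linear_on_compose[OF assms(1,2,5)] linear_on_compose[OF assms(3,4,7)]
    show "(tensor_map s3 V3 t3 W3 p2 q2 \<circ> tensor_map s2 V2 t2 W2 p1 q1) y =
        tensor_map s3 V3 t3 W3 (p2 \<circ> p1) (q2 \<circ> q1) y"
      if "y \<in> {elementary_tensor s1 V1 t1 W1 v w | v w. v \<in> V1 \<and> w \<in> W1}" for y
      using that assms(1-8) by (auto simp: tensor_map_elementary)
  qed
  then show ?thesis by simp
qed

lemma tensor_map_id:
  assumes x: "x \<in> tensor_space s V t W"
  shows "tensor_map s V t W (\<lambda>v. v) (\<lambda>w. w) x = x"
proof -
  have "tensor_map s V t W (\<lambda>v. v) (\<lambda>w. w) x = id x"
    by (rule pscale.module_hom_eq_on_span[OF module_hom_tensor_map _ _ x[unfolded tensor_space_def]])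
      (auto intro!: module_hom_pscaleI simp: tensor_map_def elementary_tensor_def fun_eq_iff)
  then show ?thesis by simp
qed

lemma bij_betw_tensor_map:
  assumes p: "linear_on s' s V' p" "bij_betw p V' V" and q: "linear_on t' t W' q" "bij_betw q W' W"
    and sub: "module.subspace s' V'" "module.subspace s V" "module.subspace t' W'" "module.subspace t W"
    and mod: "module s'" "module s" "module t'" "module t"
  shows "bij_betw (tensor_map s V t W p q) (tensor_space s' V' t' W') (tensor_space s V t W)"
proof -
  let ?p = "inv_into V' p" and ?q = "inv_into W' q"
  have p': "linear_on s s' V ?p" and q': "linear_on t t' W ?q"
    using linear_on_inv_into[OF sub(1) mod(1) p] linear_on_inv_into[OF sub(3) mod(3) q] .
  have f: "p \<in> V' \<rightarrow> V" "q \<in> W' \<rightarrow> W" "?p \<in> V \<rightarrow> V'" "?q \<in> W \<rightarrow> W'"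
    using p q by (auto simp: bij_betw_imp_funcset bij_betw_inv_into)
  have id: "linear_on r r X (\<lambda>x. x)" "(\<lambda>x. x) \<in> X \<rightarrow> X" for X and r :: "rat \<Rightarrow> 'z::ab_group_add \<Rightarrow> 'z"
    by (auto simp: linear_on_def)
  have left: "tensor_map s' V' t' W' ?p ?q (tensor_map s V t W p q x) = x"
    if x: "x \<in> tensor_space s' V' t' W'" for x
  proof -
    have "tensor_map s' V' t' W' ?p ?q (tensor_map s V t W p q x) =
        tensor_map s' V' t' W' (\<lambda>v. v) (\<lambda>w. w) x"
      unfolding tensor_map_compose[OF p(1) f(1) q(1) f(2) p' f(3) q' f(4) x]
      using p(2) q(2)
      by (intro tensor_map_cong[OF id id _ _ sub(1) mod(1) sub(3) mod(3) x])
        (auto simp: bij_betw_inv_into_left)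
    with tensor_map_id[OF x] show ?thesis by simp
  qed
  have right: "tensor_map s V t W p q (tensor_map s' V' t' W' ?p ?q x) = x"
    if x: "x \<in> tensor_space s V t W" for x
  proof -
    have "tensor_map s V t W p q (tensor_map s' V' t' W' ?p ?q x) =
        tensor_map s V t W (\<lambda>v. v) (\<lambda>w. w) x"
      unfolding tensor_map_compose[OF p' f(3) q' f(4) p(1) f(1) q(1) f(2) x]
      using p(2) q(2)
      by (intro tensor_map_cong[OF id id _ _ sub(2) mod(2) sub(4) mod(4) x])
        (auto simp: bij_betw_inv_into_right)
    with tensor_map_id[OF x] show ?thesis by simp
  qed
  show ?thesis
    using tensor_map_in_space[OF p(1) f(1) q(1) f(2)] tensor_map_in_space[OF p' f(3) q' f(4)]
    by (intro bij_betwI[where g = "tensor_map s' V' t' W' ?p ?q"]) (auto simp: left right)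
qed

section \<open>Determinants of finite sets are lines\<close>

lemma alternating_forms_pullback:
  assumes "linear_on t' t W' p" and "p \<in> W' \<rightarrow> W" and "\<alpha> \<in> alternating_forms t k W"
  shows "(\<lambda>ws. \<alpha> (map p ws)) \<in> alternating_forms t' k W'"
  unfolding alternating_forms_def
proof (intro CollectI ballI impI conjI allI)
  fix ws assume ws: "ws \<in> lists W'" "length ws = k"
  then have m: "map p ws \<in> lists W" "length (map p ws) = k"
    using assms(2) by (auto simp: Pi_iff)
  show "\<alpha> (map p ws) = 0" if "\<not> distinct ws"
    using that m assms(3) by (auto simp: alternating_forms_def distinct_map)
  fix i assume "i < k"
  then have "linear_on t (*) W (\<lambda>w. \<alpha> ((map p ws)[i := w]))"
    using m assms(3) by (auto simp: alternating_forms_def)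
  from linear_on_compose[OF assms(1,2) this]
  show "linear_on t' (*) W' (\<lambda>w. \<alpha> (map p (ws[i := w])))"
    by (simp add: o_def map_update)
qed

lemma exterior_map_wedge:
  assumes "linear_on t' t W' p" and "p \<in> W' \<rightarrow> W" and "length ws = k"
  shows "exterior_map t k W p (wedge t' W' ws) = wedge t W (map p ws)"
  using alternating_forms_pullback[OF assms(1,2)] assms(3)
  by (auto simp: exterior_map_def wedge_def fun_eq_iff)

lemma alternating_forms_Cons:
  assumes "\<alpha> \<in> alternating_forms t (Suc k) W" and "W' \<subseteq> W" and "x \<in> W"
  shows "(\<lambda>ws. \<alpha> (x # ws)) \<in> alternating_forms t k W'"
  unfolding alternating_forms_def
proof (intro CollectI ballI impI conjI allI)
  fix ws assume ws: "ws \<in> lists W'" "length ws = k"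
  then have m: "x # ws \<in> lists W" "length (x # ws) = Suc k"
    using assms(2,3) by auto
  show "\<alpha> (x # ws) = 0" if "\<not> distinct ws"
    using that m assms(1) by (auto simp: alternating_forms_def)
  fix i assume "i < k"
  then have "linear_on t (*) W (\<lambda>w. \<alpha> ((x # ws)[Suc i := w]))"
    using m assms(1) unfolding alternating_forms_def by blast
  then show "linear_on t (*) W' (\<lambda>w. \<alpha> (x # ws[i := w]))"
    using assms(2) by (auto simp: linear_on_def subset_iff)
qed

lemma wedge_left_wedge:
  assumes "W' \<subseteq> W" and "x \<in> W" and "length ws = k"
  shows "wedge_left t k W x (wedge t W' ws) = wedge t W (x # ws)"
  using alternating_forms_Cons[OF _ assms(1,2)] assms(3)
  by (auto simp: wedge_left_def wedge_def fun_eq_iff)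

lemma unit_vec_in_coord_space: "a \<in> E \<Longrightarrow> unit_vec a \<in> coord_space E"
  by (auto simp: unit_vec_def coord_space_def)

lemma subspace_coord_space: "pscale.subspace (coord_space E)"
  by (auto simp: pscale.subspace_def coord_space_def pscale_def)

lemma wedge_linear:
  assumes "xs @ w # ys \<in> lists W" and "w' \<in> W"
  shows "wedge t W (xs @ (w + w') # ys) = wedge t W (xs @ w # ys) + wedge t W (xs @ w' # ys)"
    and "wedge t W (xs @ t c w # ys) = pscale c (wedge t W (xs @ w # ys))"
proof -
  let ?k = "Suc (length xs + length ys)"
  have lin: "linear_on t (*) W (\<lambda>z. \<alpha> (xs @ z # ys))" if "\<alpha> \<in> alternating_forms t ?k W" for \<alpha>
  proof -
    have "xs @ w # ys \<in> lists W" "length (xs @ w # ys) = ?k" "length xs < ?k"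
      using assms by auto
    then have "linear_on t (*) W (\<lambda>z. \<alpha> ((xs @ w # ys)[length xs := z]))"
      using that unfolding alternating_forms_def by blast
    then show ?thesis by simp
  qed
  have "w \<in> W" using assms by simp
  with linear_onD[OF lin] assms(2)
  show "wedge t W (xs @ (w + w') # ys) = wedge t W (xs @ w # ys) + wedge t W (xs @ w' # ys)"
    and "wedge t W (xs @ t c w # ys) = pscale c (wedge t W (xs @ w # ys))"
    by (auto simp: wedge_def fun_eq_iff pscale_def)
qed

lemma wedge_not_distinct: "ws \<in> lists W \<Longrightarrow> \<not> distinct ws \<Longrightarrow> wedge t W ws = 0"
  by (auto simp: wedge_def fun_eq_iff alternating_forms_def)

text \<open>Polarisation: expand the vanishing wedge with \<open>u + w\<close> in both places.\<close>

lemma wedge_swap: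
  assumes W: "module.subspace t W" "module t" and ws: "xs @ u # w # ys \<in> lists W"
  shows "wedge t W (xs @ w # u # ys) = - wedge t W (xs @ u # w # ys)"
proof -
  interpret module t by fact
  have in_W: "u \<in> W" "w \<in> W" "u + w \<in> W" "xs \<in> lists W" "ys \<in> lists W"
    using ws subspace_add[OF W(1)] by auto
  have "0 = wedge t W (xs @ (u + w) # (u + w) # ys)"
    using in_W by (intro wedge_not_distinct[symmetric]) auto
  also have "\<dots> = wedge t W (xs @ u # (u + w) # ys) + wedge t W (xs @ w # (u + w) # ys)"
    using in_W by (intro wedge_linear) auto
  also have "wedge t W (xs @ u # (u + w) # ys) =
      wedge t W (xs @ u # u # ys) + wedge t W (xs @ u # w # ys)"
    using wedge_linear(1)[of "xs @ [u]" u ys W w t] in_W by auto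
  also have "wedge t W (xs @ w # (u + w) # ys) =
      wedge t W (xs @ w # u # ys) + wedge t W (xs @ w # w # ys)"
    using wedge_linear(1)[of "xs @ [w]" u ys W w t] in_W by auto
  also have "wedge t W (xs @ u # u # ys) = 0"
    using in_W by (intro wedge_not_distinct) auto
  also have "wedge t W (xs @ w # w # ys) = 0"
    using in_W by (intro wedge_not_distinct) auto
  finally show ?thesis
    by (metis add.left_neutral add.right_neutral eq_neg_iff_add_eq_0 add.commute)
qed

lemma wedge_move_front:
  assumes W: "module.subspace t W" "module t" and ws: "xs @ us @ w # ys \<in> lists W"
  shows "wedge t W (xs @ us @ w # ys) \<in> {wedge t W (xs @ w # us @ ys), - wedge t W (xs @ w # us @ ys)}"
  using ws
proof (induction us arbitrary: xs)
  case (Cons u us)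
  have "wedge t W ((xs @ [u]) @ us @ w # ys) \<in>
      {wedge t W ((xs @ [u]) @ w # us @ ys), - wedge t W ((xs @ [u]) @ w # us @ ys)}"
    using Cons.prems by (intro Cons.IH) auto
  moreover have "wedge t W (xs @ w # u # us @ ys) = - wedge t W (xs @ u # w # us @ ys)"
    using Cons.prems by (intro wedge_swap[OF W]) auto
  ultimately show ?case by auto
qed simp

lemma wedge_permute:
  assumes W: "module.subspace t W" "module t" and "mset ws = mset ws'" and "xs @ ws \<in> lists W"
  shows "wedge t W (xs @ ws) \<in> {wedge t W (xs @ ws'), - wedge t W (xs @ ws')}"
  using assms(3,4)
proof (induction ws' arbitrary: ws xs)
  case (Cons w ws')
  then have "w \<in> set ws"
    by (metis list.set_intros(1) mset_eq_setD)
  then obtain us ys where ws: "ws = us @ w # ys"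
    by (meson split_list)
  have "wedge t W ((xs @ [w]) @ us @ ys) \<in>
      {wedge t W ((xs @ [w]) @ ws'), - wedge t W ((xs @ [w]) @ ws')}"
    using Cons.prems unfolding ws by (intro Cons.IH) auto
  moreover have "wedge t W (xs @ us @ w # ys) \<in>
      {wedge t W (xs @ w # us @ ys), - wedge t W (xs @ w # us @ ys)}"
    using Cons.prems unfolding ws by (intro wedge_move_front[OF W]) auto
  ultimately show ?case
    by (auto simp: ws)
qed simp

text \<open>The expansion of all factors in the standard basis, by induction on the factors \<open>ws\<close> that still
  have to be expanded; those in front of them are already basis vectors.\<close>

lemma wedge_in_span_unit_vecs:
  assumes E: "finite E" and ws: "set fs \<subseteq> E" "ws \<in> lists (coord_space E)"
  shows "wedge pscale (coord_space E) (map unit_vec fs @ ws) \<in>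
    pscale.span {wedge pscale (coord_space E) (map unit_vec fs') | fs'.
      set fs' \<subseteq> E \<and> length fs' = length fs + length ws}"
  using ws
proof (induction ws arbitrary: fs)
  case Nil
  then show ?case by (auto intro!: pscale.span_base)
next
  case (Cons w ws)
  let ?W = "coord_space E"
  let ?S = "pscale.span {wedge pscale ?W (map unit_vec fs') | fs'.
      set fs' \<subseteq> E \<and> length fs' = length fs + length (w # ws)}"
  have units: "map unit_vec fs \<in> lists ?W"
    using Cons.prems by (auto intro!: unit_vec_in_coord_space)
  have unit: "wedge pscale ?W (map unit_vec fs @ unit_vec b # ws) \<in> ?S" if "b \<in> E" for b
    using Cons.IH[of "fs @ [b]"] Cons.prems that by simp
  have part: "wedge pscale ?W (map unit_vec fs @ (\<lambda>x. if x \<in> F then w x else 0) # ws) \<in> ?S"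
    if "finite F" "F \<subseteq> E" for F
    using that
  proof (induction F)
    case empty
    have "(\<lambda>x. 0) = pscale 0 w" by (simp add: pscale_def)
    with wedge_linear(2)[of "map unit_vec fs" w ws ?W w pscale 0] units Cons.prems
    have "wedge pscale ?W (map unit_vec fs @ (\<lambda>x. if x \<in> {} then w x else 0) # ws) = 0"
      by auto
    then show ?case
      by (metis (lifting) pscale.span_zero)
  next
    case (insert b F)
    let ?w = "\<lambda>x. if x \<in> F then w x else 0"
    have w: "?w \<in> ?W" "pscale (w b) (unit_vec b) \<in> ?W" "unit_vec b \<in> ?W"
      using Cons.prems insert by (auto simp: coord_space_def unit_vec_def pscale_def)
    have "(\<lambda>x. if x \<in> insert b F then w x else 0) = ?w + pscale (w b) (unit_vec b)"
      using insert by (auto simp: fun_eq_iff pscale_def unit_vec_def)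
    then have "wedge pscale ?W (map unit_vec fs @ (\<lambda>x. if x \<in> insert b F then w x else 0) # ws) =
        wedge pscale ?W (map unit_vec fs @ ?w # ws) +
        wedge pscale ?W (map unit_vec fs @ pscale (w b) (unit_vec b) # ws)"
      using wedge_linear(1)[of "map unit_vec fs" ?w ws ?W "pscale (w b) (unit_vec b)" pscale]
        units w Cons.prems by auto
    also have "wedge pscale ?W (map unit_vec fs @ pscale (w b) (unit_vec b) # ws) =
        pscale (w b) (wedge pscale ?W (map unit_vec fs @ unit_vec b # ws))"
      using units w Cons.prems by (intro wedge_linear) auto
    finally have *: "wedge pscale ?W (map unit_vec fs @ (\<lambda>x. if x \<in> insert b F then w x else 0) # ws) =
        wedge pscale ?W (map unit_vec fs @ ?w # ws) +
        pscale (w b) (wedge pscale ?W (map unit_vec fs @ unit_vec b # ws))" .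
    show ?case
      unfolding * using insert by (intro pscale.span_add pscale.span_scale unit) auto
  qed
  have "(\<lambda>x. if x \<in> E then w x else 0) = w"
    using Cons.prems by (auto simp: coord_space_def fun_eq_iff)
  with part[OF E] show ?case by simp
qed

text \<open>Among the wedges of basis vectors, those with a repeated factor vanish and the others are
  permutations of a single one, hence equal to it up to sign.\<close>

lemma det_space_eq_span:
  assumes es: "distinct es" "set es = E"
  shows "det_space E = pscale.span {wedge pscale (coord_space E) (map unit_vec es)}"
proof -
  let ?W = "coord_space E" and ?S = "pscale.span {wedge pscale (coord_space E) (map unit_vec es)}"
  have E: "finite E" and card: "card E = length es"
    using es distinct_card by force+
  have fs: "wedge pscale ?W (map unit_vec fs) \<in> ?S" if "set fs \<subseteq> E" "length fs = card E" for fs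
  proof (cases "distinct fs")
    case True
    then have "set fs = E"
      using that E by (metis card_subset_eq distinct_card)
    then have "mset (map unit_vec fs) = mset (map unit_vec es)"
      using True es by (metis mset_map set_eq_iff_mset_eq_distinct)
    moreover have "map unit_vec fs \<in> lists ?W"
      using that by (auto intro!: unit_vec_in_coord_space)
    ultimately show ?thesis
      using wedge_permute[OF subspace_coord_space pscale.module_axioms,
          of "map unit_vec fs" "map unit_vec es" "[]" E]
        pscale.span_base[of "wedge pscale ?W (map unit_vec es)" "{wedge pscale ?W (map unit_vec es)}"]
      by (auto intro: pscale.span_neg)
  next
    case False
    then have "\<not> distinct (map unit_vec fs)"
      by (simp add: distinct_map)
    with that show ?thesis
      by (subst wedge_not_distinct) (auto intro!: unit_vec_in_coord_space simp: pscale.span_zero)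
  qed
  have "det_space E \<subseteq> ?S"
    unfolding det_space_def exterior_power_def
  proof (rule pscale.span_minimal[OF _ pscale.subspace_span])
    show "{wedge pscale ?W ws |ws. ws \<in> lists ?W \<and> length ws = card E} \<subseteq> ?S"
    proof
      fix \<omega> assume "\<omega> \<in> {wedge pscale ?W ws |ws. ws \<in> lists ?W \<and> length ws = card E}"
      then obtain ws where \<omega>: "\<omega> = wedge pscale ?W ws" and "ws \<in> lists ?W" "length ws = card E"
        by blast
      then have "wedge pscale ?W ws \<in> pscale.span {wedge pscale ?W (map unit_vec fs') | fs'.
          set fs' \<subseteq> E \<and> length fs' = card E}"
        using wedge_in_span_unit_vecs[OF E, of "[]" ws] by auto
      moreover have "pscale.span {wedge pscale ?W (map unit_vec fs') | fs'.
          set fs' \<subseteq> E \<and> length fs' = card E} \<subseteq> ?S"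
        using fs by (intro pscale.span_minimal[OF _ pscale.subspace_span]) auto
      ultimately show "\<omega> \<in> ?S" unfolding \<omega> by blast
    qed
  qed
  moreover have "?S \<subseteq> det_space E"
    unfolding det_space_def exterior_power_def using es card
    by (intro pscale.span_mono) (auto intro!: exI[of _ "map unit_vec es"] simp: unit_vec_in_coord_space)
  ultimately show ?thesis by blast
qed

text \<open>The determinant of the coordinates is the form that detects the wedge of the standard basis.  When
  two entries agree, composition with their transposition pairs each term of the Leibniz formula with
  its negative.\<close>

lemma leibniz_alternating:
  assumes k: "k = length es"
  shows "(\<lambda>ws. \<Sum>\<pi> | \<pi> permutes {..<k}. rat_of_int (sign \<pi>) * (\<Prod>i<k. (ws ! i) (es ! \<pi> i)))
    \<in> alternating_forms pscale k W"
    (is "?D \<in> _")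
  unfolding alternating_forms_def
proof (intro CollectI ballI impI conjI allI)
  fix ws :: "('a \<Rightarrow> rat) list" assume ws: "length ws = k"
  show "linear_on pscale (*) W (\<lambda>w. ?D (ws[i := w]))" if i: "i < k" for i
  proof -
    have *: "(\<Prod>j<k. ((ws[i := w]) ! j) (es ! \<pi> j)) =
        w (es ! \<pi> i) * (\<Prod>j\<in>{..<k} - {i}. (ws ! j) (es ! \<pi> j))" for w \<pi>
      using i ws by (subst prod.remove[of _ i]) (auto intro!: prod.cong)
    show ?thesis
      unfolding * linear_on_def
      by (auto simp: pscale_def algebra_simps sum.distrib sum_distrib_left)
  qed
  show "?D ws = 0" if nd: "\<not> distinct ws"
  proof -
    obtain a b where ab: "a < k" "b < k" "a \<noteq> b" "ws ! a = ws ! b"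
      using nd ws by (auto simp: distinct_conv_nth)
    let ?t = "Transposition.transpose a b"
    have t: "?t permutes {..<k}"
      using ab by (intro permutes_swap_id) auto
    have "?D ws = (\<Sum>\<pi> | \<pi> permutes {..<k}. - (rat_of_int (sign \<pi>) * (\<Prod>i<k. (ws ! i) (es ! \<pi> i))))"
    proof (rule sum.reindex_bij_witness[of _ "\<lambda>\<pi>. \<pi> \<circ> ?t" "\<lambda>\<pi>. \<pi> \<circ> ?t"])
      fix \<pi> assume \<pi>: "\<pi> \<in> {\<pi>. \<pi> permutes {..<k}}"
      show "\<pi> \<circ> ?t \<circ> ?t = \<pi>" "\<pi> \<circ> ?t \<circ> ?t = \<pi>"
        by (simp_all add: o_assoc[symmetric])
      show "\<pi> \<circ> ?t \<in> {\<pi>. \<pi> permutes {..<k}}" "\<pi> \<circ> ?t \<in> {\<pi>. \<pi> permutes {..<k}}"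
        using \<pi> t by (auto intro: permutes_compose)
      have "sign (\<pi> \<circ> ?t) = - sign \<pi>"
        using \<pi> t ab by (subst sign_compose)
          (auto simp: sign_swap_id intro: permutes_imp_permutation[of "{..<k}"])
      moreover have "(\<Prod>i<k. (ws ! i) (es ! (\<pi> \<circ> ?t) i)) = (\<Prod>i<k. (ws ! i) (es ! \<pi> i))"
      proof (rule prod.reindex_bij_witness[of _ ?t ?t])
        fix i assume "i \<in> {..<k}"
        then show "?t i \<in> {..<k}" "?t i \<in> {..<k}"
          using permutes_in_image[OF t] by blast+
        show "(ws ! ?t i) (es ! \<pi> (?t i)) = (ws ! i) (es ! (\<pi> \<circ> ?t) i)"
          using ab by (auto simp: Transposition.transpose_def)
      qed auto
      ultimately show "- (rat_of_int (sign (\<pi> \<circ> ?t)) * (\<Prod>i<k. (ws ! i) (es ! (\<pi> \<circ> ?t) i))) =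
          rat_of_int (sign \<pi>) * (\<Prod>i<k. (ws ! i) (es ! \<pi> i))"
        by simp
    qed
    then show ?thesis by (simp add: sum_negf)
  qed
qed

lemma wedge_unit_vecs_nonzero:
  assumes es: "distinct es"
  shows "wedge pscale W (map unit_vec es) \<noteq> 0"
proof
  let ?k = "length es"
  let ?D = "\<lambda>ws. \<Sum>\<pi> | \<pi> permutes {..<?k}. rat_of_int (sign \<pi>) * (\<Prod>i<?k. (ws ! i) (es ! \<pi> i))"
  assume "wedge pscale W (map unit_vec es) = 0"
  then have "0 = ?D (map unit_vec es)"
    using leibniz_alternating[of ?k es W] by (auto simp: wedge_def fun_eq_iff dest!: spec[of _ ?D])
  also have "\<dots> = (\<Sum>\<pi> | \<pi> permutes {..<?k}. if \<pi> = id then 1 else 0)"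
  proof (intro sum.cong refl)
    fix \<pi> assume "\<pi> \<in> {\<pi>. \<pi> permutes {..<?k}}"
    then have \<pi>: "\<pi> permutes {..<?k}" by simp
    show "rat_of_int (sign \<pi>) * (\<Prod>i<?k. (map unit_vec es ! i) (es ! \<pi> i)) = (if \<pi> = id then 1 else 0)"
    proof (cases "\<pi> = id")
      case True
      then show ?thesis by (simp add: unit_vec_def)
    next
      case False
      then obtain i where i: "\<pi> i \<noteq> i" "i < ?k"
        using \<pi> by (auto simp: fun_eq_iff permutes_def)
      moreover have "\<pi> i < ?k" using \<pi> i by (meson lessThan_iff permutes_in_image)
      ultimately have "(map unit_vec es ! i) (es ! \<pi> i) = 0"
        using es by (auto simp: unit_vec_def nth_eq_iff_index_eq)
      with i(2) False show ?thesis by auto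
    qed
  qed
  also have "\<dots> = 1"
    by (simp add: sum.delta finite_permutations permutes_id)
  finally show False by simp
qed

lemma bij_betw_line:
  assumes F: "module_hom pscale pscale F" and Fu: "F u = w" and w: "w \<noteq> (0 :: 'y \<Rightarrow> rat)"
  shows "bij_betw F (pscale.span {u}) (pscale.span {w})"
proof -
  interpret module_hom pscale pscale F by fact
  have "F ` pscale.span {u} = pscale.span {w}"
    using span_image[of "{u}"] Fu by simp
  moreover have "inj_on F (pscale.span {u})"
    using w by (auto simp: inj_on_def pscale.span_singleton scale Fu)
  ultimately show ?thesis by (simp add: bij_betw_def)
qed

section \<open>Isomorphisms and contractions of multigraphs\<close>

text \<open>An isomorphism is handled through its two components, a bijection of vertices and a bijection of
  half-edges; composition and inversion are then componentwise.\<close>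

definition cell_map :: "('v, 'h) mgraph \<Rightarrow> ('v \<Rightarrow> 'v) \<Rightarrow> ('h \<Rightarrow> 'h) \<Rightarrow> 'v + 'h \<Rightarrow> 'v + 'h" where
  "cell_map G p q = restrict (map_sum p q) (cells G)"

definition iso_pair :: "('v, 'h) mgraph \<Rightarrow> ('v, 'h) mgraph \<Rightarrow> ('v \<Rightarrow> 'v) \<Rightarrow> ('h \<Rightarrow> 'h) \<Rightarrow> bool" where
  "iso_pair G G' p q \<longleftrightarrow> bij_betw p (verts G) (verts G') \<and> bij_betw q (halves G) (halves G') \<and>
     (\<forall>h\<in>halves G. root G' (q h) = p (root G h) \<and> mate G' (q h) = q (mate G h))"

lemma multigraphD:
  assumes "multigraph G"
  shows "finite (verts G)" and "finite (halves G)"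
    and "h \<in> halves G \<Longrightarrow> root G h \<in> verts G" and "h \<in> halves G \<Longrightarrow> mate G h \<in> halves G"
    and "h \<in> halves G \<Longrightarrow> mate G h \<noteq> h" and "h \<in> halves G \<Longrightarrow> mate G (mate G h) = h"
  using assms by (auto simp: multigraph_def)

lemma cell_map_simps [simp]:
  "v \<in> verts G \<Longrightarrow> cell_map G p q (Inl v) = Inl (p v)"
  "h \<in> halves G \<Longrightarrow> cell_map G p q (Inr h) = Inr (q h)"
  by (auto simp: cell_map_def cells_def)

lemma cells_iff [simp]: "Inl v \<in> cells G \<longleftrightarrow> v \<in> verts G" "Inr h \<in> cells G \<longleftrightarrow> h \<in> halves G"
  by (auto simp: cells_def)

lemma cell_map_extensional [simp]: "cell_map G p q \<in> extensional (cells G)"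
  by (simp add: cell_map_def)

lemma iso_pair_imp_isos:
  assumes "multigraph G" and "iso_pair G G' p q"
  shows "cell_map G p q \<in> isos G G'"
proof -
  have p: "bij_betw p (verts G) (verts G')" and q: "bij_betw q (halves G) (halves G')"
    and c: "\<And>h. h \<in> halves G \<Longrightarrow> root G' (q h) = p (root G h) \<and> mate G' (q h) = q (mate G h)"
    using assms(2) by (auto simp: iso_pair_def)
  have "bij_betw (cell_map G p q) (Inl ` verts G) (Inl ` verts G')"
    using p by (auto simp: bij_betw_def inj_on_def image_image cong: image_cong)
  moreover have "bij_betw (cell_map G p q) (Inr ` halves G) (Inr ` halves G')"
    using q by (auto simp: bij_betw_def inj_on_def image_image cong: image_cong)
  ultimately show ?thesis
    using c multigraphD(3,4)[OF assms(1)] by (auto simp: isos_def)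
qed

lemma isosE:
  assumes "multigraph G" and "f \<in> isos G G'"
  obtains p q where "f = cell_map G p q" and "iso_pair G G' p q"
proof
  define p q where "p = (\<lambda>v. projl (f (Inl v)))" and "q = (\<lambda>h. projr (f (Inr h)))"
  have bv: "bij_betw f (Inl ` verts G) (Inl ` verts G')"
    and bh: "bij_betw f (Inr ` halves G) (Inr ` halves G')"
    and ext: "f \<in> extensional (cells G)"
    and c: "\<And>h. h \<in> halves G \<Longrightarrow> \<exists>h'. f (Inr h) = Inr h' \<and>
        f (Inl (root G h)) = Inl (root G' h') \<and> f (Inr (mate G h)) = Inr (mate G' h')"
    using assms by (auto simp: isos_def)
  have v: "f (Inl v) = Inl (p v)" if "v \<in> verts G" for v
    using bij_betw_apply[OF bv, of "Inl v"] that by (auto simp: p_def)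
  have h: "f (Inr h) = Inr (q h)" if "h \<in> halves G" for h
    using c[OF that] by (auto simp: q_def)
  show "f = cell_map G p q"
    by (rule extensionalityI[OF ext cell_map_extensional]) (auto simp: cells_def v h)
  have "f ` Inl ` verts G = Inl ` p ` verts G" "f ` Inr ` halves G = Inr ` q ` halves G"
    by (auto simp: image_image v h)
  then have "p ` verts G = verts G'" "q ` halves G = halves G'"
    using bv bh by (simp_all add: bij_betw_def inj_image_eq_iff)
  moreover have "inj_on p (verts G)" "inj_on q (halves G)"
    using bv bh by (auto simp: bij_betw_def inj_on_def v h)
  ultimately have "bij_betw p (verts G) (verts G')" "bij_betw q (halves G) (halves G')"
    by (simp_all add: bij_betw_def)
  moreover have "root G' (q h) = p (root G h) \<and> mate G' (q h) = q (mate G h)"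
    if "h \<in> halves G" for h
    using c[OF that] by (auto simp: p_def q_def)
  ultimately show "iso_pair G G' p q"
    by (simp add: iso_pair_def)
qed

lemma iso_pair_compose:
  assumes "iso_pair G G' p q" and "iso_pair G' G'' p' q'"
  shows "iso_pair G G'' (p' \<circ> p) (q' \<circ> q)"
  using assms by (auto simp: iso_pair_def bij_betw_apply intro: bij_betw_trans)

lemma iso_pair_inverse:
  assumes G: "multigraph G" and "iso_pair G G' p q"
  shows "iso_pair G' G (inv_into (verts G) p) (inv_into (halves G) q)"
proof -
  have p: "bij_betw p (verts G) (verts G')" and q: "bij_betw q (halves G) (halves G')"
    and c: "\<And>h. h \<in> halves G \<Longrightarrow> root G' (q h) = p (root G h) \<and> mate G' (q h) = q (mate G h)"
    using assms by (auto simp: iso_pair_def)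
  show ?thesis
    unfolding iso_pair_def
  proof (intro conjI ballI)
    fix h' assume "h' \<in> halves G'"
    then obtain h where h: "h \<in> halves G" "h' = q h"
      using q by (auto simp: bij_betw_def)
    then show "root G (inv_into (halves G) q h') = inv_into (verts G) p (root G' h')"
      and "mate G (inv_into (halves G) q h') = inv_into (halves G) q (mate G' h')"
      using c[of h] p q multigraphD[OF G] by (simp_all add: bij_betw_inv_into_left)
  qed (use p q in \<open>auto intro: bij_betw_inv_into\<close>)
qed

lemma compose_cell_map:
  assumes "iso_pair G G' p q"
  shows "compose (cells G) (cell_map G' p' q') (cell_map G p q) = cell_map G (p' \<circ> p) (q' \<circ> q)"
  using assms by (auto simp: compose_def cell_map_def cells_def iso_pair_def bij_betw_apply fun_eq_iff)

lemma isos_compose: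
  assumes "multigraph G" and "multigraph G'" and "f \<in> isos G G'" and "f' \<in> isos G' G''"
  shows "compose (cells G) f' f \<in> isos G G''"
proof -
  obtain p q where f: "f = cell_map G p q" "iso_pair G G' p q"
    using isosE assms(1,3) by metis
  obtain p' q' where f': "f' = cell_map G' p' q'" "iso_pair G' G'' p' q'"
    using isosE assms(2,4) by metis
  show ?thesis
    unfolding f(1) f'(1) compose_cell_map[OF f(2)]
    by (rule iso_pair_imp_isos[OF assms(1) iso_pair_compose[OF f(2) f'(2)]])
qed

lemma isos_bij_betw: "f \<in> isos G G' \<Longrightarrow> bij_betw f (cells G) (cells G')"
  unfolding cells_def isos_def by (auto intro!: bij_betw_combine)

lemma isos_inverse:
  assumes "multigraph G" and "multigraph G'" and "f \<in> isos G G'"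
  shows "restrict (inv_into (cells G) f) (cells G') \<in> isos G' G"
proof -
  obtain p q where f: "f = cell_map G p q" "iso_pair G G' p q"
    using isosE assms(1,3) by metis
  have b: "bij_betw f (cells G) (cells G')"
    by (rule isos_bij_betw[OF assms(3)])
  have p: "bij_betw p (verts G) (verts G')" and q: "bij_betw q (halves G) (halves G')"
    using f by (auto simp: iso_pair_def)
  have "restrict (inv_into (cells G) f) (cells G') =
      cell_map G' (inv_into (verts G) p) (inv_into (halves G) q)"
  proof (rule extensionalityI[of _ "cells G'"])
    fix x assume "x \<in> cells G'"
    then consider v where "v \<in> verts G" "x = Inl (p v)" | h where "h \<in> halves G" "x = Inr (q h)"
      using p q unfolding cells_def bij_betw_def by blast
    then show "restrict (inv_into (cells G) f) (cells G') x =
        cell_map G' (inv_into (verts G) p) (inv_into (halves G) q) x"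
    proof cases
      case 1
      then have "inv_into (cells G) f x = Inl v"
        using bij_betw_inv_into_left[OF b, of "Inl v"] f by simp
      with 1 p show ?thesis by (simp add: bij_betw_inv_into_left bij_betw_apply)
    next
      case 2
      then have "inv_into (cells G) f x = Inr h"
        using bij_betw_inv_into_left[OF b, of "Inr h"] f by simp
      with 2 q show ?thesis by (simp add: bij_betw_inv_into_left bij_betw_apply)
    qed
  qed simp_all
  with iso_pair_imp_isos[OF assms(2) iso_pair_inverse[OF assms(1) f(2)]] show ?thesis by simp
qed

lemma id_in_isos:
  assumes "multigraph G"
  shows "(\<lambda>c\<in>cells G. c) \<in> isos G G"
proof -
  have "cell_map G id id = (\<lambda>c\<in>cells G. c)"
    unfolding cell_map_def map_sum.id by (simp add: id_def)
  with iso_pair_imp_isos[OF assms, of G id id] show ?thesis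
    by (simp add: iso_pair_def)
qed

lemma edge_image_cell_map: "b \<subseteq> halves G \<Longrightarrow> edge_image (cell_map G p q) b = q ` b"
  by (force simp: edge_image_def)

lemma edges_subset: "multigraph G \<Longrightarrow> b \<in> edges G \<Longrightarrow> b \<subseteq> halves G"
  by (auto simp: edges_def multigraph_def)

lemma nonloop_edges_subset: "nonloop_edges G \<subseteq> edges G"
  by (auto simp: edges_def nonloop_edges_def)

lemma finite_edges: "multigraph G \<Longrightarrow> finite (edges G)"
  by (auto simp: edges_def multigraphD)

lemma edge_eqI:
  assumes "multigraph G" and "a \<in> edges G" and "h \<in> a"
  shows "a = {h, mate G h}" and "h \<in> halves G"
  using assms by (auto simp: edges_def multigraph_def)

lemma iso_pair_bij_edges:
  assumes G: "multigraph G" and pq: "iso_pair G G' p q"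
  shows "bij_betw ((`) q) (edges G) (edges G')"
    and "bij_betw ((`) q) (nonloop_edges G) (nonloop_edges G')"
proof -
  have p: "bij_betw p (verts G) (verts G')" and q: "bij_betw q (halves G) (halves G')"
    and c: "\<And>h. h \<in> halves G \<Longrightarrow> root G' (q h) = p (root G h) \<and> mate G' (q h) = q (mate G h)"
    using pq by (auto simp: iso_pair_def)
  have inj: "inj_on ((`) q) (Pow (halves G))"
    using q by (auto simp: bij_betw_def inj_on_image_eq_iff inj_on_def[of "(`) q"])
  have nl: "p (root G h) = p (root G (mate G h)) \<longleftrightarrow> root G h = root G (mate G h)" if "h \<in> halves G" for h
    using p that multigraphD[OF G] by (auto simp: bij_betw_def inj_on_eq_iff)
  have q_image: "halves G' = q ` halves G" using q by (simp add: bij_betw_def)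
  have "(`) q ` edges G = edges G'"
    unfolding edges_def q_image using c by (auto simp: image_iff) (metis image_insert image_empty)+
  moreover have "(`) q ` nonloop_edges G = nonloop_edges G'"
    unfolding nonloop_edges_def q_image using c nl multigraphD[OF G]
    by (auto simp: image_iff) (metis image_insert image_empty)+
  moreover have "edges G \<subseteq> Pow (halves G)" "nonloop_edges G \<subseteq> Pow (halves G)"
    using edges_subset[OF G] nonloop_edges_subset by auto
  ultimately show "bij_betw ((`) q) (edges G) (edges G')"
    and "bij_betw ((`) q) (nonloop_edges G) (nonloop_edges G')"
    using inj by (auto simp: bij_betw_def intro: inj_on_subset)
qed

lemma isos_bij_edges:
  assumes G: "multigraph G" and f: "f \<in> isos G G'"
  shows "bij_betw (edge_image f) (edges G) (edges G')"
    and "bij_betw (edge_image f) (nonloop_edges G) (nonloop_edges G')"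
proof -
  obtain p q where pq: "f = cell_map G p q" "iso_pair G G' p q"
    using isosE[OF G f] .
  have "edge_image f b = q ` b" if "b \<in> edges G" for b
    unfolding pq(1) using edge_image_cell_map edges_subset[OF G that] by blast
  with iso_pair_bij_edges[OF G pq(2)] nonloop_edges_subset[of G]
  show "bij_betw (edge_image f) (edges G) (edges G')"
    and "bij_betw (edge_image f) (nonloop_edges G) (nonloop_edges G')"
    by (auto cong: bij_betw_cong simp: subset_iff)
qed

lemma merged_vertex_in: "a \<noteq> {} \<Longrightarrow> merged_vertex G a \<in> root G ` a"
  unfolding merged_vertex_def by (rule someI_ex) auto

lemma merge_eq_iff:
  "a \<noteq> {} \<Longrightarrow> merge G a u = merge G a v \<longleftrightarrow> u = v \<or> u \<in> root G ` a \<and> v \<in> root G ` a"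
  using merged_vertex_in[of a G] by (auto simp: merge_def)

lemma merge_idem: "merge G a (merge G a v) = merge G a v"
  using merged_vertex_in[of a G] by (auto simp: merge_def)

lemma multigraph_contract:
  assumes G: "multigraph G" and a: "a \<in> edges G"
  shows "multigraph (contract G a)"
proof -
  have "mate G h \<notin> a" if "h \<in> halves G" "h \<notin> a" for h
    using edge_eqI(1)[OF G a, of "mate G h"] that multigraphD(6)[OF G] by auto
  then show ?thesis
    using multigraphD[OF G] by (auto simp: multigraph_def contract_def)
qed

lemma edges_contract:
  assumes G: "multigraph G" and a: "a \<in> edges G"
  shows "edges (contract G a) = edges G - {a}"
proof
  show "edges (contract G a) \<subseteq> edges G - {a}"
    by (auto simp: edges_def contract_def)
  show "edges G - {a} \<subseteq> edges (contract G a)"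
  proof
    fix b assume b: "b \<in> edges G - {a}"
    then obtain h where h: "h \<in> halves G" "b = {h, mate G h}"
      by (auto simp: edges_def)
    then have "h \<notin> a"
      using edge_eqI[OF G a, of h] b by auto
    with h show "b \<in> edges (contract G a)"
      by (auto simp: edges_def contract_def)
  qed
qed

text \<open>An isomorphism descends to the contractions of corresponding edges.  The merged vertices of \<open>G\<close> and
  \<open>H\<close> are chosen independently, so \<open>p\<close> need not carry one to the other; this is why \<open>p\<close> has to be
  followed by the merging in \<open>H\<close>.\<close>

lemma iso_pair_contract:
  assumes G: "multigraph G" and a: "a \<in> edges G" and pq: "iso_pair G H p q"
  shows "iso_pair (contract G a) (contract H (q ` a)) (merge H (q ` a) \<circ> p) q"
    and "v \<in> verts G \<Longrightarrow> merge H (q ` a) (p (merge G a v)) = merge H (q ` a) (p v)"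
proof -
  let ?b = "q ` a"
  have p: "bij_betw p (verts G) (verts H)" and q: "bij_betw q (halves G) (halves H)"
    and c: "\<And>h. h \<in> halves G \<Longrightarrow> root H (q h) = p (root G h) \<and> mate H (q h) = q (mate G h)"
    using pq by (auto simp: iso_pair_def)
  have ne: "a \<noteq> {}" "?b \<noteq> {}" and sub: "a \<subseteq> halves G"
    using a edges_subset[OF G] by (auto simp: edges_def)
  have ends: "root H ` ?b = p ` root G ` a"
    using c sub by (force simp: image_image)
  have ends_sub: "root G ` a \<subseteq> verts G"
    using sub multigraphD(3)[OF G] by auto
  have p_ends: "p v \<in> root H ` ?b \<longleftrightarrow> v \<in> root G ` a" if "v \<in> verts G" for v
    unfolding ends using p ends_sub that by (meson bij_betw_def inj_on_image_mem_iff)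
  have merge_in: "merge G a v \<in> verts G" if "v \<in> verts G" for v
    using that merged_vertex_in[OF ne(1), of G] ends_sub by (auto simp: merge_def)
  have eq: "merge H ?b (p u) = merge H ?b (p v) \<longleftrightarrow> merge G a u = merge G a v"
    if "u \<in> verts G" "v \<in> verts G" for u v
    using that p unfolding merge_eq_iff[OF ne(1)] merge_eq_iff[OF ne(2)]
    by (auto simp: p_ends bij_betw_def inj_on_eq_iff)
  show *: "merge H ?b (p (merge G a v)) = merge H ?b (p v)" if "v \<in> verts G" for v
    using that by (simp add: eq merge_in merge_idem)
  have "bij_betw (merge H ?b \<circ> p) (merge G a ` verts G) (merge H ?b ` verts H)"
    unfolding bij_betw_def
  proof
    show "inj_on (merge H ?b \<circ> p) (merge G a ` verts G)"
      by (auto simp: inj_on_def eq merge_in merge_idem)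
    have "verts H = p ` verts G" using p by (simp add: bij_betw_def)
    then show "(merge H ?b \<circ> p) ` merge G a ` verts G = merge H ?b ` verts H"
      by (auto simp: image_image * cong: image_cong)
  qed
  moreover have "bij_betw q (halves G - a) (halves H - ?b)"
    using q sub by (intro bij_betw_DiffI) (auto simp: bij_betw_def intro: inj_on_subset)
  ultimately show "iso_pair (contract G a) (contract H ?b) (merge H ?b \<circ> p) q"
    using c * multigraphD(3)[OF G] by (auto simp: iso_pair_def contract_def)
qed

lemma contraction_simps:
  "v \<in> verts G \<Longrightarrow> contraction G a (Inl v) = Inl (merge G a v)"
  "h \<in> halves G \<Longrightarrow> h \<notin> a \<Longrightarrow> contraction G a (Inr h) = Inr h"
  "h \<in> halves G \<Longrightarrow> h \<in> a \<Longrightarrow> contraction G a (Inr h) = Inl (merge G a (root G h))"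
  by (auto simp: contraction_def merge_def)

lemma contraction_image:
  assumes G: "multigraph G" and a: "a \<in> edges G"
  shows "contraction G a ` cells G = cells (contract G a)"
proof
  have ne: "a \<noteq> {}" and sub: "a \<subseteq> halves G"
    using a edges_subset[OF G] by (auto simp: edges_def)
  show "contraction G a ` cells G \<subseteq> cells (contract G a)"
  proof clarify
    fix x assume "x \<in> cells G"
    then consider v where "x = Inl v" "v \<in> verts G" | h where "x = Inr h" "h \<in> halves G"
      by (auto simp: cells_def)
    then show "contraction G a x \<in> cells (contract G a)"
    proof cases
      case 2
      then show ?thesis
        using multigraphD(3)[OF G, of h]
        by (cases "h \<in> a") (auto simp: contraction_simps contract_def)
    qed (auto simp: contraction_simps contract_def)
  qed
  show "cells (contract G a) \<subseteq> contraction G a ` cells G"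
  proof
    fix x assume "x \<in> cells (contract G a)"
    then consider v where "x = Inl (merge G a v)" "v \<in> verts G"
      | h where "x = Inr h" "h \<in> halves G" "h \<notin> a"
      by (auto simp: cells_def contract_def)
    then show "x \<in> contraction G a ` cells G"
    proof cases
      case 1
      then show ?thesis by (intro image_eqI[of _ _ "Inl v"]) (auto simp: contraction_simps)
    next
      case 2
      then show ?thesis by (intro image_eqI[of _ _ "Inr h"]) (auto simp: contraction_simps)
    qed
  qed
qed

lemma iso_descends:
  assumes G: "multigraph G" and H: "multigraph H" and a: "a \<in> edges G" and \<psi>: "\<psi> \<in> isos G H"
  obtains \<chi> where "\<chi> \<in> isos (contract G a) (contract H (edge_image \<psi> a))"
    and "\<And>x. x \<in> cells G \<Longrightarrow> contraction H (edge_image \<psi> a) (\<psi> x) = \<chi> (contraction G a x)"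
proof -
  obtain p q where pq: "\<psi> = cell_map G p q" "iso_pair G H p q"
    using isosE[OF G \<psi>] .
  have sub: "a \<subseteq> halves G" using edges_subset[OF G a] .
  have im: "edge_image \<psi> a = q ` a"
    unfolding pq(1) by (rule edge_image_cell_map[OF sub])
  have p: "bij_betw p (verts G) (verts H)" and q: "bij_betw q (halves G) (halves H)"
    and c: "\<And>h. h \<in> halves G \<Longrightarrow> root H (q h) = p (root G h)"
    using pq by (auto simp: iso_pair_def)
  let ?\<chi> = "cell_map (contract G a) (merge H (q ` a) \<circ> p) q"
  have "?\<chi> \<in> isos (contract G a) (contract H (q ` a))"
    by (intro iso_pair_imp_isos multigraph_contract iso_pair_contract G a pq)
  moreover have "contraction H (q ` a) (\<psi> x) = ?\<chi> (contraction G a x)" if x: "x \<in> cells G" for x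
  proof -
    have v: "merge G a v \<in> verts (contract G a)" if "v \<in> verts G" for v
      using that by (simp add: contract_def)
    have h: "q h \<in> q ` a \<longleftrightarrow> h \<in> a" "q h \<in> halves H" if "h \<in> halves G" for h
      using that q sub by (meson bij_betw_def inj_on_image_mem_iff, meson bij_betw_apply)
    have w: "p v \<in> verts H" if "v \<in> verts G" for v
      using that p by (auto simp: bij_betw_def)
    from x consider v where "x = Inl v" "v \<in> verts G"
      | h where "x = Inr h" "h \<in> halves G" "h \<in> a" | h where "x = Inr h" "h \<in> halves G" "h \<notin> a"
      by (auto simp: cells_def)
    then show ?thesis
    proof cases
      case 1
      then show ?thesis
        using v w iso_pair_contract(2)[OF G a pq(2)] by (simp add: pq(1) contraction_simps)
    next
      case 2
      then have "root G h \<in> verts G" using multigraphD(3)[OF G] by blast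
      with 2 show ?thesis
        using v w h c iso_pair_contract(2)[OF G a pq(2)] by (simp add: pq(1) contraction_simps)
    next
      case 3
      then have "h \<in> halves (contract G a)" by (simp add: contract_def)
      with 3 h show ?thesis by (simp add: pq(1) contraction_simps)
    qed
  qed
  ultimately show ?thesis
    using that by (simp add: im)
qed

lemma contract_along_apply:
  "x \<in> cells G \<Longrightarrow> contract_along G a f x = f (contraction G a x)"
  by (simp add: contract_along_def compose_def)

lemma contract_along_image:
  assumes "multigraph G" and "a \<in> edges G" and "f \<in> isos (contract G a) G'"
  shows "contract_along G a f ` cells G = cells G'"
proof -
  have "contract_along G a f ` cells G = f ` contraction G a ` cells G"
    by (auto simp: contract_along_apply image_image cong: image_cong)
  then show ?thesis
    using contraction_image[OF assms(1,2)] isos_bij_betw[OF assms(3)] by (simp add: bij_betw_def)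
qed

text \<open>The common source of the induced automorphisms (\<open>\<psi>\<close> fixes the edge), of the independence of choices
  (\<open>\<psi> = id\<close>) and of the equivariance of the differential: \<open>\<psi>\<close> descends to an isomorphism from \<open>G/a\<close> to
  \<open>G/\<psi>(a)\<close>, and \<open>f\<close> and \<open>f'\<close> transport it to \<open>G'\<close>.\<close>

lemma contract_along_compare:
  assumes G: "multigraph G" and G': "multigraph G'" and a: "a \<in> edges G" and \<psi>: "\<psi> \<in> isos G G"
    and f: "f \<in> isos (contract G a) G'" and f': "f' \<in> isos (contract G (edge_image \<psi> a)) G'"
  obtains \<eta> where "\<eta> \<in> isos G' G'"
    and "compose (cells G) \<eta> (contract_along G a f) =
      compose (cells G) (contract_along G (edge_image \<psi> a) f') \<psi>"
proof -
  let ?b = "edge_image \<psi> a"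
  have b: "?b \<in> edges G"
    using isos_bij_edges(1)[OF G \<psi>] a by (rule bij_betw_apply)
  obtain \<chi> where \<chi>: "\<chi> \<in> isos (contract G a) (contract G ?b)"
    and \<chi>_eq: "\<And>x. x \<in> cells G \<Longrightarrow> contraction G ?b (\<psi> x) = \<chi> (contraction G a x)"
    using iso_descends[OF G G a \<psi>] by blast
  note K = multigraph_contract[OF G a] multigraph_contract[OF G b]
  let ?fi = "restrict (inv_into (cells (contract G a)) f) (cells G')"
  define \<eta> where "\<eta> = compose (cells G') f' (compose (cells G') \<chi> ?fi)"
  have "\<eta> \<in> isos G' G'"
    unfolding \<eta>_def
    by (intro isos_compose[OF G' K(2) _ f'] isos_compose[OF G' K(1) _ \<chi>] isos_inverse K G' f)
  moreover have "compose (cells G) \<eta> (contract_along G a f) =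
      compose (cells G) (contract_along G ?b f') \<psi>"
  proof (rule extensionalityI[of _ "cells G"])
    fix x assume x: "x \<in> cells G"
    have cx: "contraction G a x \<in> cells (contract G a)"
      using contraction_image[OF G a] x by blast
    have fx: "f (contraction G a x) \<in> cells G'"
      using isos_bij_betw[OF f] cx by (rule bij_betw_apply)
    have "\<psi> x \<in> cells G"
      using isos_bij_betw[OF \<psi>] x by (rule bij_betw_apply)
    then show "compose (cells G) \<eta> (contract_along G a f) x =
        compose (cells G) (contract_along G ?b f') \<psi> x"
      using x fx cx bij_betw_inv_into_left[OF isos_bij_betw[OF f] cx]
      by (simp add: compose_def contract_along_apply \<eta>_def \<chi>_eq)
  qed (simp_all add: compose_def)
  ultimately show ?thesis by (rule that)
qed

section \<open>Contractions preserve the genus\<close>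

lemma nonloop_edgeE:
  assumes "a \<in> nonloop_edges G"
  obtains h where "h \<in> halves G" and "a = {h, mate G h}" and "root G h \<noteq> root G (mate G h)"
  using assms by (auto simp: nonloop_edges_def)

text \<open>One edge and one vertex disappear, and walks are pushed forward along the merging of
  vertices.\<close>

lemma contract_in_Grph:
  assumes G: "G \<in> Grph g" and a: "a \<in> nonloop_edges G"
  shows "contract G a \<in> Grph g"
proof -
  have mg: "multigraph G" and con: "connected_graph G" and gen: "genus G = int g"
    using G by (auto simp: Grph_def)
  have ae: "a \<in> edges G" using a nonloop_edges_subset by blast
  obtain h where h: "h \<in> halves G" "a = {h, mate G h}" "root G h \<noteq> root G (mate G h)"
    using nonloop_edgeE[OF a] .
  let ?m = "merge G a" and ?K = "contract G a"
  have ne: "a \<noteq> {}" using h by simp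
  have adj: "(?m (root G k), ?m (root G (mate G k))) \<in>
      {(root ?K h, root ?K (mate ?K h)) | h. h \<in> halves ?K}\<^sup>*" if k: "k \<in> halves G" for k
  proof (cases "k \<in> a")
    case True
    then have "mate G k \<in> a" using edge_eqI(1)[OF mg ae True] by auto
    with True have "?m (root G k) = ?m (root G (mate G k))"
      unfolding merge_eq_iff[OF ne] by blast
    then show ?thesis by simp
  next
    case False
    with k have "k \<in> halves ?K" "root ?K k = ?m (root G k)"
      "root ?K (mate ?K k) = ?m (root G (mate G k))"
      by (simp_all add: contract_def)
    then show ?thesis by (intro r_into_rtrancl) (metis (mono_tags, lifting) mem_Collect_eq)
  qed
  have path: "(?m u, ?m v) \<in> {(root ?K h, root ?K (mate ?K h)) | h. h \<in> halves ?K}\<^sup>*"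
    if "(u, v) \<in> {(root G h, root G (mate G h)) | h. h \<in> halves G}\<^sup>*" for u v
    using that
  proof induction
    case (step v w)
    then obtain k where "k \<in> halves G" "v = root G k" "w = root G (mate G k)" by blast
    with step.IH adj[of k] show ?case by (metis (no_types, lifting) rtrancl_trans)
  qed simp
  have con': "connected_graph ?K"
    unfolding connected_graph_def
  proof (intro conjI ballI)
    show "verts ?K \<noteq> {}" using con by (auto simp: contract_def connected_graph_def)
    fix u v assume "u \<in> verts ?K" "v \<in> verts ?K"
    then obtain u' v' where uv: "u' \<in> verts G" "v' \<in> verts G" "u = ?m u'" "v = ?m v'"
      by (auto simp: contract_def)
    then have "(u', v') \<in> {(root G h, root G (mate G h)) | h. h \<in> halves G}\<^sup>*"
      using con by (auto simp: connected_graph_def)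
    from path[OF this] uv show "(u, v) \<in> {(root ?K h, root ?K (mate ?K h)) | h. h \<in> halves ?K}\<^sup>*"
      by simp
  qed
  obtain x y where xy: "root G ` a = {x, y}" "x \<noteq> y" "merged_vertex G a = x"
  proof -
    have "root G ` a = {root G h, root G (mate G h)}" using h(2) by simp
    then show ?thesis
      using that[of "root G h" "root G (mate G h)"] that[of "root G (mate G h)" "root G h"]
        merged_vertex_in[OF ne, of G] h(3) by (auto simp: insert_commute)
  qed
  have xy_in: "x \<in> verts G" "y \<in> verts G"
  proof -
    have "root G ` a \<subseteq> verts G"
      using edges_subset[OF mg ae] multigraphD(3)[OF mg] by auto
    then show "x \<in> verts G" "y \<in> verts G" by (auto simp: xy(1))
  qed
  have "verts ?K = verts G - {y}"
    using xy xy_in by (auto simp: contract_def merge_def)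
  then have "card (verts G) = Suc (card (verts ?K))"
    using xy_in multigraphD(1)[OF mg] by (metis card_Suc_Diff1)
  moreover have "card (edges G) = Suc (card (edges ?K))"
    unfolding edges_contract[OF mg ae] using ae finite_edges[OF mg] by (metis card_Suc_Diff1)
  ultimately show ?thesis
    using gen con' multigraph_contract[OF mg ae] by (auto simp: Grph_def genus_def)
qed

lemma morphism_contract_along:
  assumes G: "G \<in> Grph g" and G': "G' \<in> Grph g" and a: "a \<in> nonloop_edges G"
    and f: "f \<in> isos (contract G a) G'"
  shows "morphism g G (contract_along G a f) G'"
  unfolding contract_along_def
  by (rule morphism.comp[OF morphism.contraction[OF G a]
        morphism.iso[OF contract_in_Grph[OF G a] G' f]])

text \<open>Without a further half-edge at its ends, a non-loop edge would be the whole connected graph, and the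
  genus would be 0.\<close>

lemma ex_adjacent_half:
  assumes G: "G \<in> Grph g" and g: "g \<ge> 1" and a: "a \<in> nonloop_edges G"
  shows "\<exists>k\<in>halves G. k \<notin> a \<and> root G k \<in> root G ` a"
proof (rule ccontr)
  assume none: "\<not> (\<exists>k\<in>halves G. k \<notin> a \<and> root G k \<in> root G ` a)"
  have mg: "multigraph G" and con: "connected_graph G" and gen: "genus G = int g"
    using G by (auto simp: Grph_def)
  have ae: "a \<in> edges G" using a nonloop_edges_subset by blast
  obtain h where h: "h \<in> halves G" "a = {h, mate G h}" "root G h \<noteq> root G (mate G h)"
    using nonloop_edgeE[OF a] .
  have in_a: "k \<in> a" if "k \<in> halves G" "root G k \<in> root G ` a" for k
    using none that by blast
  have reach: "v \<in> root G ` a"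
    if "(root G h, v) \<in> {(root G h, root G (mate G h)) | h. h \<in> halves G}\<^sup>*" for v
    using that
  proof induction
    case base
    show ?case using h by simp
  next
    case (step v w)
    then obtain k where k: "k \<in> halves G" "v = root G k" "w = root G (mate G k)" by blast
    then have "k \<in> a" using in_a step.IH by simp
    then have "mate G k \<in> a" using edge_eqI(1)[OF mg ae, of k] by simp
    with k show ?case by simp
  qed
  have "root G h \<in> verts G" using multigraphD(3)[OF mg h(1)] .
  then have "verts G \<subseteq> root G ` a"
    using reach con by (auto simp: connected_graph_def)
  moreover have "root G ` a \<subseteq> verts G"
    using edges_subset[OF mg ae] multigraphD(3)[OF mg] by blast
  ultimately have verts: "verts G = root G ` a" by blast
  then have "halves G \<subseteq> a"
    using in_a multigraphD(3)[OF mg] by blast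
  then have "b = a" if b: "b \<in> edges G" for b
  proof -
    obtain k where k: "k \<in> b" "k \<in> halves G" using b unfolding edges_def by blast
    with \<open>halves G \<subseteq> a\<close> have "k \<in> a" by blast
    with k show ?thesis using edge_eqI(1)[OF mg ae] edge_eqI(1)[OF mg b] by metis
  qed
  with ae have "edges G = {a}" by blast
  moreover have "card (verts G) = 2"
    using h by (simp add: verts)
  ultimately show False
    using gen g by (simp add: genus_def)
qed

section \<open>Automorphisms fixing an edge\<close>

lemma carrier_Aut [simp]: "carrier (Aut G) = isos G G"
  by (simp add: Aut_def)

lemma isos_subset_Bij: "isos G G \<subseteq> Bij (cells G)"
  using isos_bij_betw by (auto simp: Bij_def isos_def)

lemma mult_Aut:
  "x \<in> isos G G \<Longrightarrow> y \<in> isos G G \<Longrightarrow> x \<otimes>\<^bsub>Aut G\<^esub> y = compose (cells G) x y"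
  using isos_subset_Bij[of G] by (auto simp: Aut_def BijGroup_def)

lemma group_Aut:
  assumes G: "multigraph G"
  shows "group (Aut G)"
proof -
  interpret B: group "BijGroup (cells G)" by (rule group_BijGroup)
  have "subgroup (isos G G) (BijGroup (cells G))"
  proof (rule B.subgroupI)
    show "isos G G \<subseteq> carrier (BijGroup (cells G))"
      using isos_subset_Bij by (simp add: BijGroup_def)
    show "isos G G \<noteq> {}" using id_in_isos[OF G] by blast
    show "inv\<^bsub>BijGroup (cells G)\<^esub> f \<in> isos G G" if "f \<in> isos G G" for f
      using isos_inverse[OF G G that] subsetD[OF isos_subset_Bij that] by (simp add: inv_BijGroup)
    show "f \<otimes>\<^bsub>BijGroup (cells G)\<^esub> f' \<in> isos G G" if "f \<in> isos G G" "f' \<in> isos G G" for f f'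
      using isos_compose[OF G G that(2,1)] that[THEN subsetD[OF isos_subset_Bij]]
      by (simp add: BijGroup_def)
  qed
  then show ?thesis
    unfolding Aut_def by (rule B.subgroup_imp_group)
qed

lemma edge_image_compose:
  assumes "\<And>h. h \<in> b \<Longrightarrow> h \<in> halves G" and "\<And>h. h \<in> b \<Longrightarrow> \<exists>h'. f (Inr h) = Inr h'"
  shows "edge_image (compose (cells G) f' f) b = edge_image f' (edge_image f b)"
proof -
  have "f ` Inr ` b = Inr ` edge_image f b"
    using assms(2) by (fastforce simp: edge_image_def)
  moreover have "compose (cells G) f' f ` Inr ` b = f' ` f ` Inr ` b"
    using assms(1) by (auto simp: compose_def image_image)
  ultimately show ?thesis by (simp add: edge_image_def)
qed

lemma isos_Inr: "f \<in> isos G G' \<Longrightarrow> h \<in> halves G \<Longrightarrow> \<exists>h'\<in>halves G'. f (Inr h) = Inr h'"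
  by (auto simp: isos_def dest: bij_betw_apply)

lemma edge_image_isos_compose:
  assumes "multigraph G" and "b \<in> edges G" and "f \<in> isos G G'"
  shows "edge_image (compose (cells G) f' f) b = edge_image f' (edge_image f b)"
  using edges_subset[OF assms(1,2)] isos_Inr[OF assms(3)] by (intro edge_image_compose) blast+

lemma edge_image_id: "b \<subseteq> halves G \<Longrightarrow> edge_image (\<lambda>c\<in>cells G. c) b = b"
  by (force simp: edge_image_def)

lemma one_Aut: "\<one>\<^bsub>Aut G\<^esub> = (\<lambda>c\<in>cells G. c)"
  by (simp add: Aut_def BijGroup_def)

lemma subgroup_stab:
  assumes G: "multigraph G" and a: "a \<in> edges G"
  shows "subgroup (stab G a) (Aut G)"
proof -
  interpret group "Aut G" by (rule group_Aut[OF G])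
  note comp = edge_image_isos_compose[OF G a]
  show ?thesis
  proof (rule subgroupI)
    show "stab G a \<subseteq> carrier (Aut G)" by (auto simp: stab_def)
    show "stab G a \<noteq> {}"
      using id_in_isos[OF G] edge_image_id[OF edges_subset[OF G a]] by (auto simp: stab_def)
    fix x assume x: "x \<in> stab G a"
    then have xi: "x \<in> isos G G" "edge_image x a = a" by (auto simp: stab_def)
    then have yi: "inv\<^bsub>Aut G\<^esub> x \<in> isos G G" using inv_closed[of x] by simp
    have "compose (cells G) (inv\<^bsub>Aut G\<^esub> x) x = (\<lambda>c\<in>cells G. c)"
      using l_inv[of x] xi yi by (simp add: mult_Aut one_Aut)
    then have "edge_image (inv\<^bsub>Aut G\<^esub> x) a = a"
      using comp[OF xi(1), of "inv\<^bsub>Aut G\<^esub> x"] xi edge_image_id[OF edges_subset[OF G a]] by simp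
    with yi show "inv\<^bsub>Aut G\<^esub> x \<in> stab G a" by (simp add: stab_def)
    fix y assume y: "y \<in> stab G a"
    with x show "x \<otimes>\<^bsub>Aut G\<^esub> y \<in> stab G a"
      using isos_compose[OF G G] by (auto simp: stab_def mult_Aut comp)
  qed
qed

lemma carrier_stab_group [simp]: "carrier (stab_group G a) = stab G a"
  by (simp add: stab_group_def)

lemma mult_stab_group: "x \<otimes>\<^bsub>stab_group G a\<^esub> y = x \<otimes>\<^bsub>Aut G\<^esub> y"
  by (simp add: stab_group_def)

lemma group_stab_group: "multigraph G \<Longrightarrow> a \<in> edges G \<Longrightarrow> group (stab_group G a)"
  unfolding stab_group_def by (rule group.subgroup_imp_group[OF group_Aut subgroup_stab])

text \<open>The contraction is onto the cells of \<open>G'\<close>, so an automorphism of \<open>G'\<close> is determined by its composite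
  with it.  This makes induced automorphisms unique, hence multiplicative.\<close>

lemma compose_contract_along_cancel:
  assumes G: "multigraph G" and a: "a \<in> edges G" and f: "f \<in> isos (contract G a) G'"
    and \<eta>: "\<eta> \<in> isos G' G'" "\<eta>' \<in> isos G' G'"
    and eq: "compose (cells G) \<eta> (contract_along G a f) = compose (cells G) \<eta>' (contract_along G a f)"
  shows "\<eta> = \<eta>'"
proof (rule extensionalityI[of _ "cells G'"])
  show "\<eta> \<in> extensional (cells G')" "\<eta>' \<in> extensional (cells G')"
    using \<eta> by (auto simp: isos_def)
  fix y assume "y \<in> cells G'"
  then obtain x where "x \<in> cells G" "y = contract_along G a f x"
    using contract_along_image[OF G a f] by blast
  with fun_cong[OF eq, of x] show "\<eta> y = \<eta>' y"
    by (simp add: compose_def)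
qed

lemma induced_aut:
  assumes G: "multigraph G" and G': "multigraph G'" and a: "a \<in> edges G"
    and f: "f \<in> isos (contract G a) G'" and \<psi>: "\<psi> \<in> stab G a"
  shows "induced_aut G G' a f \<psi> \<in> isos G' G'"
    and "compose (cells G) (induced_aut G G' a f \<psi>) (contract_along G a f) =
      compose (cells G) (contract_along G a f) \<psi>"
proof -
  have "\<psi> \<in> isos G G" "edge_image \<psi> a = a"
    using \<psi> by (auto simp: stab_def)
  then obtain \<eta> where "\<eta> \<in> isos G' G'"
    "compose (cells G) \<eta> (contract_along G a f) = compose (cells G) (contract_along G a f) \<psi>"
    using contract_along_compare[OF G G' a, of \<psi> f f] f by metis
  then have "\<exists>!\<eta>. \<eta> \<in> carrier (Aut G') \<and>
      compose (cells G) \<eta> (contract_along G a f) = compose (cells G) (contract_along G a f) \<psi>"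
    using compose_contract_along_cancel[OF G a f] by (intro ex1I[of _ \<eta>]) auto
  from theI'[OF this]
  show "induced_aut G G' a f \<psi> \<in> isos G' G'"
    and "compose (cells G) (induced_aut G G' a f \<psi>) (contract_along G a f) =
      compose (cells G) (contract_along G a f) \<psi>"
    by (auto simp: induced_aut_def)
qed

lemma group_hom_induced_aut:
  assumes G: "multigraph G" and G': "multigraph G'" and a: "a \<in> edges G"
    and f: "f \<in> isos (contract G a) G'"
  shows "group_hom (stab_group G a) (Aut G') (induced_aut G G' a f)"
proof -
  note ind = induced_aut[OF G G' a f]
  let ?P = "contract_along G a f"
  have "induced_aut G G' a f (x \<otimes>\<^bsub>stab_group G a\<^esub> y) =
      induced_aut G G' a f x \<otimes>\<^bsub>Aut G'\<^esub> induced_aut G G' a f y"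
    if x: "x \<in> stab G a" and y: "y \<in> stab G a" for x y
  proof -
    let ?h = "induced_aut G G' a f"
    have xy: "x \<otimes>\<^bsub>Aut G\<^esub> y \<in> stab G a"
      using subgroup.m_closed[OF subgroup_stab[OF G a] x y] .
    have xi: "x \<in> isos G G" and yi: "y \<in> isos G G"
      using x y by (auto simp: stab_def)
    have "compose (cells G) (compose (cells G') (?h x) (?h y)) ?P =
        compose (cells G) ?P (compose (cells G) x y)"
    proof (rule extensionalityI[of _ "cells G"])
      fix c assume c: "c \<in> cells G"
      have yc: "y c \<in> cells G" and Pc: "?P c \<in> cells G'"
        using bij_betw_apply[OF isos_bij_betw[OF yi] c] contract_along_image[OF G a f] c by auto
      have "?h x (?h y (?P c)) = ?h x (?P (y c))"
        using fun_cong[OF ind(2)[OF y], of c] c by (simp add: compose_def)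
      also have "\<dots> = ?P (x (y c))"
        using fun_cong[OF ind(2)[OF x], of "y c"] yc by (simp add: compose_def)
      finally show "compose (cells G) (compose (cells G') (?h x) (?h y)) ?P c =
          compose (cells G) ?P (compose (cells G) x y) c"
        using c Pc by (simp add: compose_def)
    qed (simp_all add: compose_def)
    then have "?h (x \<otimes>\<^bsub>Aut G\<^esub> y) = compose (cells G') (?h x) (?h y)"
      using ind(2)[OF xy] xi yi
      by (intro compose_contract_along_cancel[OF G a f ind(1)[OF xy]
            isos_compose[OF G' G' ind(1)[OF y] ind(1)[OF x]]]) (simp add: mult_Aut)
    then show ?thesis
      by (simp add: mult_stab_group mult_Aut ind x y)
  qed
  then show ?thesis
    using group_stab_group[OF G a] group_Aut[OF G'] ind(1)
    by (auto simp: group_hom_def group_hom_axioms_def hom_def)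
qed

text \<open>Two automorphisms fixing \<open>a\<close> that agree after contraction differ at most by swapping the two halves
  of \<open>a\<close>.  They agree on a further half-edge \<open>k\<close> at one end of \<open>a\<close>, hence on its root, and this rules
  the swap out.\<close>

lemma inj_on_induced_aut:
  assumes G: "G \<in> Grph g" and g: "g \<ge> 1" and G': "multigraph G'" and a: "a \<in> nonloop_edges G"
    and f: "f \<in> isos (contract G a) G'"
  shows "inj_on (induced_aut G G' a f) (stab G a)"
proof (rule inj_onI)
  have mg: "multigraph G" using G by (simp add: Grph_def)
  have ae: "a \<in> edges G" using a nonloop_edges_subset by blast
  have sub: "a \<subseteq> halves G" and ne: "a \<noteq> {}"
    using edges_subset[OF mg ae] ae by (auto simp: edges_def)
  fix x y assume x: "x \<in> stab G a" and y: "y \<in> stab G a"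
    and eq: "induced_aut G G' a f x = induced_aut G G' a f y"
  have xi: "x \<in> isos G G" "edge_image x a = a" and yi: "y \<in> isos G G" "edge_image y a = a"
    using x y by (auto simp: stab_def)
  obtain p q where pq: "x = cell_map G p q" "iso_pair G G p q" using isosE[OF mg xi(1)] .
  obtain p' q' where pq': "y = cell_map G p' q'" "iso_pair G G p' q'" using isosE[OF mg yi(1)] .
  have qa: "q ` a = a" "q' ` a = a"
    using xi yi pq pq' by (simp_all add: edge_image_cell_map[OF sub])
  have p: "bij_betw p (verts G) (verts G)" and q: "bij_betw q (halves G) (halves G)"
    and c: "\<And>h. h \<in> halves G \<Longrightarrow> root G (q h) = p (root G h) \<and> mate G (q h) = q (mate G h)"
    and p': "bij_betw p' (verts G) (verts G)" and q': "bij_betw q' (halves G) (halves G)"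
    and c': "\<And>h. h \<in> halves G \<Longrightarrow> root G (q' h) = p' (root G h) \<and> mate G (q' h) = q' (mate G h)"
    using pq pq' by (auto simp: iso_pair_def)
  have same: "contraction G a (x k) = contraction G a (y k)" if k: "k \<in> cells G" for k
  proof -
    have xk: "x k \<in> cells G" "y k \<in> cells G"
      using bij_betw_apply[OF isos_bij_betw k] xi yi by auto
    have "compose (cells G) (contract_along G a f) x = compose (cells G) (contract_along G a f) y"
      using induced_aut(2)[OF mg G' ae f] x y eq by metis
    from fun_cong[OF this, of k] k xk
    have "f (contraction G a (x k)) = f (contraction G a (y k))"
      by (simp add: compose_def contract_along_apply)
    moreover have "contraction G a (x k) \<in> cells (contract G a)"
      "contraction G a (y k) \<in> cells (contract G a)"
      using contraction_image[OF mg ae] xk by blast+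
    ultimately show ?thesis
      using isos_bij_betw[OF f] by (auto simp: bij_betw_def inj_on_eq_iff)
  qed
  have out: "q h = q' h" if h: "h \<in> halves G" "h \<notin> a" for h
  proof -
    have "q h \<in> halves G" "q' h \<in> halves G"
      using h q q' by (auto simp: bij_betw_apply)
    moreover have "q h \<notin> a" "q' h \<notin> a"
      using inj_on_image_mem_iff[OF bij_betw_imp_inj_on[OF q] h(1) sub]
        inj_on_image_mem_iff[OF bij_betw_imp_inj_on[OF q'] h(1) sub] h(2) qa by simp_all
    ultimately have "q h \<notin> a" "q' h \<notin> a" "q h \<in> halves G" "q' h \<in> halves G"
      by auto
    with same[of "Inr h"] h show ?thesis by (simp add: pq pq' contraction_simps)
  qed
  obtain k where k: "k \<in> halves G" "k \<notin> a" "root G k \<in> root G ` a"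
    using ex_adjacent_half[OF G g a] by blast
  then obtain h where h: "h \<in> a" "root G k = root G h" by blast
  have hG: "h \<in> halves G" "a = {h, mate G h}" using edge_eqI[OF mg ae h(1)] by auto
  have "root G (q h) = root G (q' h)"
    using c[OF k(1)] c'[OF k(1)] c[OF hG(1)] c'[OF hG(1)] out[OF k(1,2)] h(2) by metis
  moreover have ne': "root G h \<noteq> root G (mate G h)"
    using nonloop_edgeE[OF a] hG multigraphD(6)[OF mg] by (metis doubleton_eq_iff)
  moreover have "q h \<in> a" "q' h \<in> a" using qa h by auto
  ultimately have "q h = q' h" using hG(2) by auto
  moreover have "q (mate G h) = q' (mate G h)"
    using c[OF hG(1)] c'[OF hG(1)] calculation by metis
  ultimately have qq: "q k = q' k" if "k \<in> halves G" for k
    using out[OF that] hG(2) by (cases "k \<in> a") auto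
  have pp: "p v = p' v" if v: "v \<in> verts G" for v
  proof (cases "v \<in> root G ` a")
    case True
    then obtain h where "h \<in> halves G" "v = root G h" using sub by blast
    then show ?thesis using c[of h] c'[of h] qq[of h] by metis
  next
    case False
    have "p ` root G ` a = root G ` q ` a"
      unfolding image_image using c sub by (intro image_cong) auto
    then have ends: "p ` root G ` a = root G ` a"
      by (simp add: qa)
    moreover have "root G ` a \<subseteq> verts G"
      using sub multigraphD(3)[OF mg] by blast
    ultimately have pv: "p v \<notin> root G ` a"
      using inj_on_image_mem_iff[OF bij_betw_imp_inj_on[OF p] v, of "root G ` a"] False by simp
    moreover have "p v \<in> verts G" "p' v \<in> verts G"
      using v p p' by (auto simp: bij_betw_apply)
    then have "merge G a (p v) = merge G a (p' v)"
      using same[of "Inl v"] v by (simp add: pq(1) pq'(1) contraction_simps)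
    ultimately show ?thesis using pv by (simp add: merge_eq_iff[OF ne])
  qed
  show "x = y"
    unfolding pq(1) pq'(1)
    by (rule extensionalityI[OF cell_map_extensional cell_map_extensional])
      (auto simp: cells_def pp qq)
qed

section \<open>Graph maps on determinants\<close>

text \<open>The map from \<open>\<rat>\<^sup>E\<^sup>'\<close> to \<open>\<rat>\<^sup>E\<close> whose top exterior power is \<open>det_map\<close>.\<close>

definition edge_pullback :: "('v, 'h) mgraph \<Rightarrow> ('v + 'h \<Rightarrow> 'v + 'h) \<Rightarrow> ('h set \<Rightarrow> rat) \<Rightarrow> 'h set \<Rightarrow> rat" where
  "edge_pullback G f = (\<lambda>w a. if a \<in> edges G then w (edge_image f a) else 0)"

lemma edge_pullback_in: "edge_pullback G f w \<in> coord_space (edges G)"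
  by (simp add: edge_pullback_def coord_space_def)

lemma det_map_eq:
  "det_map G f = exterior_map pscale (card (edges G)) (coord_space (edges G)) (edge_pullback G f)"
  by (simp add: det_map_def edge_pullback_def)

lemma det_map_wedge:
  assumes "length ws = card (edges G)"
  shows "det_map G f (wedge pscale W ws) =
    wedge pscale (coord_space (edges G)) (map (edge_pullback G f) ws)"
  unfolding det_map_eq using assms
  by (intro exterior_map_wedge)
    (auto simp: linear_on_def edge_pullback_def pscale_def fun_eq_iff coord_space_def)

lemma edge_diff_det_wedge:
  assumes G: "multigraph G" and a: "a \<in> edges G" and ws: "length ws = card (edges (contract G a))"
  shows "(edge_wedge G a \<circ> det_map (contract G a) f) (wedge pscale W ws) =
    wedge pscale (coord_space (edges G)) (unit_vec a # map (edge_pullback (contract G a) f) ws)"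
proof -
  have "coord_space (edges (contract G a)) \<subseteq> coord_space (edges G)"
    unfolding edges_contract[OF G a] by (auto simp: coord_space_def)
  then show ?thesis
    using ws a unfolding edge_wedge_def o_apply det_map_wedge[OF ws]
    by (intro wedge_left_wedge) (auto intro: unit_vec_in_coord_space)
qed

lemma module_hom_det_map: "module_hom pscale pscale (det_map G f)"
  unfolding det_map_eq by (rule module_hom_exterior_map)

lemma module_hom_edge_diff_det: "module_hom pscale pscale (edge_wedge G a \<circ> det_map K f)"
  unfolding edge_wedge_def by (rule module_hom_compose[OF module_hom_det_map module_hom_wedge_left])

lemma subspace_det_space: "pscale.subspace (det_space E)"
  by (simp add: det_space_def exterior_power_def)

lemma wedge_in_det_space:
  "ws \<in> lists (coord_space E) \<Longrightarrow> length ws = card E \<Longrightarrow> wedge pscale (coord_space E) ws \<in> det_space E"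
  unfolding det_space_def exterior_power_def by (intro pscale.span_base) blast

lemma det_space_closed:
  assumes F: "module_hom pscale pscale F" and x: "x \<in> det_space E"
    and gen: "\<And>ws. length ws = card E \<Longrightarrow> F (wedge pscale (coord_space E) ws) \<in> det_space E'"
  shows "F x \<in> det_space E'"
proof -
  interpret module_hom pscale pscale F by fact
  have "det_space E \<subseteq> F -` det_space E'"
    unfolding det_space_def[of E] exterior_power_def
    using gen by (intro pscale.span_minimal subspace_vimage subspace_det_space) auto
  with x show ?thesis by blast
qed

lemma card_edges_isos: "multigraph G \<Longrightarrow> f \<in> isos G G' \<Longrightarrow> card (edges G) = card (edges G')"
  using isos_bij_edges(1) bij_betw_same_card by blast

lemma det_map_closed:
  assumes "multigraph G" and "f \<in> isos G G'" and "x \<in> det_space (edges G')"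
  shows "det_map G f x \<in> det_space (edges G)"
  using card_edges_isos[OF assms(1,2)]
  by (intro det_space_closed[OF module_hom_det_map assms(3)])
    (auto simp: det_map_wedge edge_pullback_in intro!: wedge_in_det_space)

lemma edge_pullback_unit_vec:
  assumes G: "multigraph G" and f: "f \<in> isos G G'" and a: "a \<in> edges G"
  shows "edge_pullback G f (unit_vec (edge_image f a)) = unit_vec a"
  using isos_bij_edges(1)[OF G f] a
  by (auto simp: edge_pullback_def unit_vec_def fun_eq_iff bij_betw_def inj_on_eq_iff)

text \<open>Both sides are lines, and the wedge of the basis of \<open>E(G')\<close> goes to that of \<open>E(G)\<close> with \<open>a\<close> put in
  front, which is not 0.\<close>

lemma bij_betw_edge_diff_det:
  assumes G: "multigraph G" and a: "a \<in> edges G" and f: "f \<in> isos (contract G a) G'"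
  shows "bij_betw (edge_wedge G a \<circ> det_map (contract G a) f)
    (det_space (edges G')) (det_space (edges G))"
proof -
  let ?K = "contract G a"
  have K: "multigraph ?K" and EK: "edges ?K = edges G - {a}"
    using multigraph_contract[OF G a] edges_contract[OF G a] .
  have b: "bij_betw (edge_image f) (edges ?K) (edges G')"
    by (rule isos_bij_edges(1)[OF K f])
  obtain es where es: "set es = edges ?K" "distinct es"
    using finite_distinct_list[OF finite_edges[OF K]] by blast
  let ?es' = "map (edge_image f) es"
  have es': "set ?es' = edges G'" "distinct ?es'"
    using b es by (auto simp: bij_betw_def distinct_map)
  have aes: "set (a # es) = edges G" "distinct (a # es)"
    using es a EK by auto
  have "length (map unit_vec ?es') = card (edges ?K)"
    using distinct_card[OF es(2)] es(1) by simp
  from edge_diff_det_wedge[OF G a this]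
  have "(edge_wedge G a \<circ> det_map ?K f) (wedge pscale (coord_space (edges G')) (map unit_vec ?es')) =
      wedge pscale (coord_space (edges G))
        (unit_vec a # map (edge_pullback ?K f) (map unit_vec ?es'))" .
  also have "map (edge_pullback ?K f) (map unit_vec ?es') = map unit_vec es"
    using edge_pullback_unit_vec[OF K f] es by simp
  finally have *: "(edge_wedge G a \<circ> det_map ?K f)
      (wedge pscale (coord_space (edges G')) (map unit_vec ?es')) =
      wedge pscale (coord_space (edges G)) (map unit_vec (a # es))"
    by simp
  show ?thesis
    unfolding det_space_eq_span[OF es'(2,1)] det_space_eq_span[OF aes(2,1)]
  proof (rule bij_betw_line)
    show "module_hom pscale pscale (edge_wedge G a \<circ> det_map ?K f)"
      by (rule module_hom_edge_diff_det)
  qed (fact *, rule wedge_unit_vecs_nonzero[OF aes(2)])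
qed

text \<open>On a wedge of vectors, both sides pull the vectors back from \<open>E(G')\<close> to \<open>E(G) - {a}\<close>, along the two
  equal composites, and put \<open>a\<close> in front: the pullback along \<open>\<psi>\<close> takes \<open>\<psi>(a)\<close> to \<open>a\<close>.\<close>

lemma edge_diff_det_equivariant:
  assumes G: "multigraph G" and G': "multigraph G'" and a: "a \<in> edges G"
    and \<psi>: "\<psi> \<in> isos G G" and \<eta>: "\<eta> \<in> isos G' G'"
    and f: "f \<in> isos (contract G a) G'" and f': "f' \<in> isos (contract G (edge_image \<psi> a)) G'"
    and eq: "compose (cells G) \<eta> (contract_along G a f) =
      compose (cells G) (contract_along G (edge_image \<psi> a) f') \<psi>"
    and \<omega>: "\<omega> \<in> det_space (edges G')"
  shows "det_map G \<psi> ((edge_wedge G (edge_image \<psi> a) \<circ> det_map (contract G (edge_image \<psi> a)) f') \<omega>) =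
    (edge_wedge G a \<circ> det_map (contract G a) f) (det_map G' \<eta> \<omega>)"
proof -
  let ?b = "edge_image \<psi> a"
  let ?K = "contract G a" and ?L = "contract G ?b"
  have \<psi>_edges: "bij_betw (edge_image \<psi>) (edges G) (edges G)"
    by (rule isos_bij_edges(1)[OF G \<psi>])
  have b: "?b \<in> edges G"
    using \<psi>_edges a by (rule bij_betw_apply)
  have K: "multigraph ?K" "edges ?K = edges G - {a}" and L: "multigraph ?L" "edges ?L = edges G - {?b}"
    using multigraph_contract edges_contract G a b by blast+
  have along: "edge_image (contract_along G d k) c = edge_image k c" "\<And>h. h \<in> c \<Longrightarrow> h \<in> halves (contract G d)"
    "\<And>h. h \<in> c \<Longrightarrow> contract_along G d k (Inr h) = k (Inr h)"
    if d: "d \<in> edges G" and c: "c \<in> edges (contract G d)" for d c k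
  proof -
    show h: "h \<in> halves (contract G d)" if "h \<in> c" for h
      using edges_subset[OF multigraph_contract[OF G d] c] that by blast
    then show *: "contract_along G d k (Inr h) = k (Inr h)" if "h \<in> c" for h
      using that by (auto simp: contract_along_apply contraction_simps contract_def)
    show "edge_image (contract_along G d k) c = edge_image k c"
      by (simp add: edge_image_def image_image * cong: image_cong)
  qed
  have \<psi>_K: "edge_image \<psi> c \<in> edges ?L \<longleftrightarrow> c \<in> edges ?K" if "c \<in> edges G" for c
    using that \<psi>_edges a unfolding K(2) L(2) by (auto simp: bij_betw_def inj_on_eq_iff)
  have image_eq: "edge_image f' (edge_image \<psi> c) = edge_image \<eta> (edge_image f c)"
    if c: "c \<in> edges ?K" for c
  proof -
    have cG: "c \<in> edges G" using c K(2) by blast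
    have "edge_image \<eta> (edge_image f c) = edge_image \<eta> (edge_image (contract_along G a f) c)"
      using along(1)[OF a c] by simp
    also have "\<dots> = edge_image (compose (cells G) \<eta> (contract_along G a f)) c"
      using edges_subset[OF G cG] along(2,3)[OF a c] isos_Inr[OF f]
      by (intro edge_image_compose[symmetric]) (auto, metis)
    also have "\<dots> = edge_image (compose (cells G) (contract_along G ?b f') \<psi>) c"
      by (simp add: eq)
    also have "\<dots> = edge_image (contract_along G ?b f') (edge_image \<psi> c)"
      by (rule edge_image_isos_compose[OF G cG \<psi>])
    also have "\<dots> = edge_image f' (edge_image \<psi> c)"
      using along(1)[OF b] \<psi>_K[OF cG] c by simp
    finally show ?thesis by simp
  qed
  have f_K: "edge_image f c \<in> edges G'" if "c \<in> edges ?K" for c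
    using bij_betw_apply[OF isos_bij_edges(1)[OF K(1) f] that] .
  have pull: "edge_pullback G \<psi> (edge_pullback ?L f' w) = edge_pullback ?K f (edge_pullback G' \<eta> w)" for w
  proof
    fix c
    show "edge_pullback G \<psi> (edge_pullback ?L f' w) c = edge_pullback ?K f (edge_pullback G' \<eta> w) c"
      using image_eq[of c] \<psi>_K[of c] f_K[of c] K(2)
      by (cases "c \<in> edges G") (auto simp: edge_pullback_def)
  qed
  have card: "card (edges ?K) = card (edges G')" "card (edges ?L) = card (edges G')"
    using card_edges_isos K L f f' by blast+
  have card_G: "card (edges G) = Suc (card (edges G'))"
    unfolding card(1)[symmetric] K(2) using a finite_edges[OF G] by (metis card_Suc_Diff1)
  have "(det_map G \<psi> \<circ> (edge_wedge G ?b \<circ> det_map ?L f')) \<omega> =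
      ((edge_wedge G a \<circ> det_map ?K f) \<circ> det_map G' \<eta>) \<omega>"
  proof (rule pscale.module_hom_eq_on_span[OF
        module_hom_compose[OF module_hom_edge_diff_det module_hom_det_map]
        module_hom_compose[OF module_hom_det_map module_hom_edge_diff_det] _
        \<omega>[unfolded det_space_def exterior_power_def]])
    fix \<sigma> assume "\<sigma> \<in> {wedge pscale (coord_space (edges G')) ws |ws.
      ws \<in> lists (coord_space (edges G')) \<and> length ws = card (edges G')}"
    then obtain ws where \<sigma>: "\<sigma> = wedge pscale (coord_space (edges G')) ws"
      and ws: "length ws = card (edges G')"
      by blast
    have "(det_map G \<psi> \<circ> (edge_wedge G ?b \<circ> det_map ?L f')) \<sigma> =
        det_map G \<psi> (wedge pscale (coord_space (edges G)) (unit_vec ?b # map (edge_pullback ?L f') ws))"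
      using edge_diff_det_wedge[OF G b] ws card by (simp add: \<sigma>)
    also have "\<dots> = wedge pscale (coord_space (edges G))
        (map (edge_pullback G \<psi>) (unit_vec ?b # map (edge_pullback ?L f') ws))"
      by (rule det_map_wedge) (simp add: ws card_G)
    also have "map (edge_pullback G \<psi>) (unit_vec ?b # map (edge_pullback ?L f') ws) =
        unit_vec a # map (edge_pullback ?K f) (map (edge_pullback G' \<eta>) ws)"
      by (simp add: pull edge_pullback_unit_vec[OF G \<psi> a])
    also have "wedge pscale (coord_space (edges G)) \<dots> =
        (edge_wedge G a \<circ> det_map ?K f) (wedge pscale (coord_space (edges G')) (map (edge_pullback G' \<eta>) ws))"
      by (rule edge_diff_det_wedge[OF G a, symmetric]) (simp add: ws card)
    also have "wedge pscale (coord_space (edges G')) (map (edge_pullback G' \<eta>) ws) = det_map G' \<eta> \<sigma>"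
      unfolding \<sigma> by (rule det_map_wedge[OF ws, symmetric])
    finally show "(det_map G \<psi> \<circ> (edge_wedge G ?b \<circ> det_map ?L f')) \<sigma> =
        ((edge_wedge G a \<circ> det_map ?K f) \<circ> det_map G' \<eta>) \<sigma>"
      by simp
  qed
  then show ?thesis by simp
qed

section \<open>The summands of the differential\<close>

context graph_local_system
begin

abbreviation act where
  "act G \<psi> \<equiv> tensor_map scale (V G) pscale (det_space (edges G)) (VM G G \<psi>) (det_map G \<psi>)"

lemma VM_funcset: "G \<in> A \<Longrightarrow> G' \<in> A \<Longrightarrow> morphism g G f G' \<Longrightarrow> VM G G' f \<in> V G' \<rightarrow> V G"
  by (rule bij_betw_imp_funcset[OF bij_VM])

lemma subspace_twisted: "pscale.subspace (twisted scale V G)"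
  by (simp add: twisted_def tensor_space_def)

lemma act_closed:
  assumes G: "G \<in> A" "G \<in> Grph g" and \<psi>: "\<psi> \<in> isos G G" and x: "x \<in> twisted scale V G"
  shows "act G \<psi> x \<in> twisted scale V G"
proof -
  have m: "morphism g G \<psi> G" by (rule morphism.iso[OF G(2) G(2) \<psi>])
  have mg: "multigraph G" using G by (simp add: Grph_def)
  have "det_map G \<psi> \<in> det_space (edges G) \<rightarrow> det_space (edges G)"
    using det_map_closed[OF mg \<psi>] by auto
  then show ?thesis
    unfolding twisted_def
    by (rule tensor_map_in_space[OF linear_VM[OF G(1) G(1) m] VM_funcset[OF G(1) G(1) m]
          module_hom_imp_linear_on[OF module_hom_det_map] _ x[unfolded twisted_def]])
qed

lemma bij_betw_edge_diff:
  assumes G: "G \<in> A" "G \<in> Grph g" and G': "G' \<in> A" "G' \<in> Grph g"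
    and a: "a \<in> nonloop_edges G" and f: "f \<in> isos (contract G a) G'"
  shows "bij_betw (edge_diff scale V VM G G' a f) (twisted scale V G') (twisted scale V G)"
proof -
  have m: "morphism g G (contract_along G a f) G'"
    by (rule morphism_contract_along[OF G(2) G'(2) a f])
  have mg: "multigraph G" and ae: "a \<in> edges G"
    using G a nonloop_edges_subset by (auto simp: Grph_def)
  show ?thesis
    unfolding edge_diff_def twisted_def
    by (rule bij_betw_tensor_map[OF linear_VM[OF G(1) G'(1) m] bij_VM[OF G(1) G'(1) m]
          module_hom_imp_linear_on[OF module_hom_edge_diff_det] bij_betw_edge_diff_det[OF mg ae f]
          subspace_V[OF G'(1)] subspace_V[OF G(1)] subspace_det_space subspace_det_space
          module_axioms module_axioms pscale.module_axioms pscale.module_axioms])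
qed

text \<open>The commuting square of graphs becomes a commuting square of twisted spaces, by functoriality of the
  local system in one tensor factor and of determinants in the other.\<close>

lemma edge_diff_equivariant:
  assumes G: "G \<in> A" "G \<in> Grph g" and G': "G' \<in> A" "G' \<in> Grph g" and a: "a \<in> nonloop_edges G"
    and \<psi>: "\<psi> \<in> isos G G" and \<eta>: "\<eta> \<in> isos G' G'"
    and f: "f \<in> isos (contract G a) G'" and f': "f' \<in> isos (contract G (edge_image \<psi> a)) G'"
    and eq: "compose (cells G) \<eta> (contract_along G a f) =
      compose (cells G) (contract_along G (edge_image \<psi> a) f') \<psi>"
    and x: "x \<in> twisted scale V G'"
  shows "act G \<psi> (edge_diff scale V VM G G' (edge_image \<psi> a) f' x) =
    edge_diff scale V VM G G' a f (act G' \<eta> x)"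
proof -
  let ?b = "edge_image \<psi> a"
  let ?q = "\<lambda>a f. edge_wedge G a \<circ> det_map (contract G a) f"
  have mg: "multigraph G" and mg': "multigraph G'" using G G' by (auto simp: Grph_def)
  have b: "?b \<in> nonloop_edges G"
    using isos_bij_edges(2)[OF mg \<psi>] a by (rule bij_betw_apply)
  have ae: "a \<in> edges G" and be: "?b \<in> edges G" using a b nonloop_edges_subset by blast+
  have m\<psi>: "morphism g G \<psi> G" and m\<eta>: "morphism g G' \<eta> G'"
    using morphism.iso[OF G(2) G(2) \<psi>] morphism.iso[OF G'(2) G'(2) \<eta>] .
  have ma: "morphism g G (contract_along G a f) G'" and mb: "morphism g G (contract_along G ?b f') G'"
    using morphism_contract_along[OF G(2) G'(2)] a b f f' by blast+
  note lin_det = module_hom_imp_linear_on[OF module_hom_det_map]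
    and lin_diff = module_hom_imp_linear_on[OF module_hom_edge_diff_det]
  have q_fun: "?q a f \<in> det_space (edges G') \<rightarrow> det_space (edges G)"
    "?q ?b f' \<in> det_space (edges G') \<rightarrow> det_space (edges G)"
    using bij_betw_edge_diff_det[OF mg ae f] bij_betw_edge_diff_det[OF mg be f']
    by (auto simp only: bij_betw_imp_funcset)
  have d_fun: "det_map G \<psi> \<in> det_space (edges G) \<rightarrow> det_space (edges G)"
    "det_map G' \<eta> \<in> det_space (edges G') \<rightarrow> det_space (edges G')"
    using det_map_closed[OF mg \<psi>] det_map_closed[OF mg' \<eta>] by auto
  note x' = x[unfolded twisted_def]
  have "act G \<psi> (edge_diff scale V VM G G' ?b f' x) =
      tensor_map scale (V G) pscale (det_space (edges G))
        (VM G G \<psi> \<circ> VM G G' (contract_along G ?b f')) (det_map G \<psi> \<circ> ?q ?b f') x"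
    unfolding edge_diff_def
    by (rule tensor_map_compose[OF linear_VM[OF G(1) G'(1) mb] VM_funcset[OF G(1) G'(1) mb]
          lin_diff q_fun(2) linear_VM[OF G(1) G(1) m\<psi>] VM_funcset[OF G(1) G(1) m\<psi>]
          lin_det d_fun(1) x'])
  also have "\<dots> = tensor_map scale (V G) pscale (det_space (edges G))
        (VM G G' (contract_along G a f) \<circ> VM G' G' \<eta>) (?q a f \<circ> det_map G' \<eta>) x"
  proof (rule tensor_map_cong[OF _ _ _ _ _ _ subspace_V[OF G'(1)] module_axioms
        subspace_det_space pscale.module_axioms x'])
    show "linear_on scale scale (V G') (VM G G' (contract_along G a f) \<circ> VM G' G' \<eta>)"
      by (rule linear_on_compose[OF linear_VM[OF G'(1) G'(1) m\<eta>] VM_funcset[OF G'(1) G'(1) m\<eta>]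
            linear_VM[OF G(1) G'(1) ma]])
    show "VM G G' (contract_along G a f) \<circ> VM G' G' \<eta> \<in> V G' \<rightarrow> V G"
      using VM_funcset[OF G'(1) G'(1) m\<eta>] VM_funcset[OF G(1) G'(1) ma] by auto
    show "linear_on pscale pscale (det_space (edges G')) (?q a f \<circ> det_map G' \<eta>)"
      by (rule linear_on_compose[OF lin_det d_fun(2) lin_diff])
    show "?q a f \<circ> det_map G' \<eta> \<in> det_space (edges G') \<rightarrow> det_space (edges G)"
      using funcset_mem[OF q_fun(1) funcset_mem[OF d_fun(2)]] by (simp add: Pi_iff)
    show "(VM G G \<psi> \<circ> VM G G' (contract_along G ?b f')) v =
        (VM G G' (contract_along G a f) \<circ> VM G' G' \<eta>) v" if "v \<in> V G'" for v
      using VM_comp[OF G(1) G(1) G'(1) m\<psi> mb that] VM_comp[OF G(1) G'(1) G'(1) ma m\<eta> that] eq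
      by simp
    show "(det_map G \<psi> \<circ> ?q ?b f') w = (?q a f \<circ> det_map G' \<eta>) w" if "w \<in> det_space (edges G')" for w
      using edge_diff_det_equivariant[OF mg mg' ae \<psi> \<eta> f f' eq that] by simp
  qed
  also have "\<dots> = edge_diff scale V VM G G' a f (act G' \<eta> x)"
    unfolding edge_diff_def
    by (rule tensor_map_compose[OF linear_VM[OF G'(1) G'(1) m\<eta>] VM_funcset[OF G'(1) G'(1) m\<eta>]
          lin_det d_fun(2) linear_VM[OF G(1) G'(1) ma] VM_funcset[OF G(1) G'(1) ma]
          lin_diff q_fun(1) x', symmetric])
  finally show ?thesis .
qed

text \<open>On invariants the automorphism \<open>\<eta>\<close> of \<open>G'\<close> acts trivially, so the summands at edges of one orbit
  correspond, whatever isomorphisms \<open>f\<close> and \<open>f'\<close> have been chosen.\<close>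

lemma edge_diff_equivariant_invariants:
  assumes G: "G \<in> A" "G \<in> Grph g" and G': "G' \<in> A" "G' \<in> Grph g" and a: "a \<in> nonloop_edges G"
    and \<psi>: "\<psi> \<in> isos G G" and f: "f \<in> isos (contract G a) G'"
    and f': "f' \<in> isos (contract G (edge_image \<psi> a)) G'"
    and x: "x \<in> invariants scale V VM G'"
  shows "act G \<psi> (edge_diff scale V VM G G' (edge_image \<psi> a) f' x) = edge_diff scale V VM G G' a f x"
proof -
  have mg: "multigraph G" "multigraph G'" using G G' by (auto simp: Grph_def)
  have ae: "a \<in> edges G" using a nonloop_edges_subset by blast
  obtain \<eta> where \<eta>: "\<eta> \<in> isos G' G'" and eq: "compose (cells G) \<eta> (contract_along G a f) =
      compose (cells G) (contract_along G (edge_image \<psi> a) f') \<psi>"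
    using contract_along_compare[OF mg ae \<psi> f f'] .
  have "x \<in> twisted scale V G'" "act G' \<eta> x = x"
    using x \<eta> by (auto simp: invariants_def)
  with edge_diff_equivariant[OF G G' a \<psi> \<eta> f f' eq] show ?thesis by simp
qed

end

section \<open>The block of the differential\<close>

lemma isomorphic_sym: "multigraph G \<Longrightarrow> multigraph G' \<Longrightarrow> isomorphic G G' \<Longrightarrow> isomorphic G' G"
  unfolding isomorphic_def using isos_inverse by blast

lemma isomorphic_trans:
  "multigraph G \<Longrightarrow> multigraph G' \<Longrightarrow> isomorphic G G' \<Longrightarrow> isomorphic G' G'' \<Longrightarrow> isomorphic G G''"
  unfolding isomorphic_def using isos_compose by blast

lemma bij_betw_contracting_edges:
  assumes G: "multigraph G" and \<psi>: "\<psi> \<in> isos G G"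
  shows "bij_betw (edge_image \<psi>) (contracting_edges G G') (contracting_edges G G')"
proof -
  let ?C = "contracting_edges G G'"
  have sub: "?C \<subseteq> nonloop_edges G" by (auto simp: contracting_edges_def)
  then have C: "?C \<subseteq> edges G" using nonloop_edges_subset by blast
  have inj: "inj_on (edge_image \<psi>) ?C"
    using isos_bij_edges(1)[OF G \<psi>] C by (auto simp: bij_betw_def intro: inj_on_subset)
  have "edge_image \<psi> a \<in> ?C" if a: "a \<in> ?C" for a
  proof -
    have b: "edge_image \<psi> a \<in> nonloop_edges G"
      using bij_betw_apply[OF isos_bij_edges(2)[OF G \<psi>]] a sub by blast
    have K: "multigraph (contract G a)" "multigraph (contract G (edge_image \<psi> a))"
      using multigraph_contract[OF G] a b C nonloop_edges_subset by blast+
    have "a \<in> edges G" using a C by blast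
    from iso_descends[OF G G this \<psi>]
    have "isomorphic (contract G a) (contract G (edge_image \<psi> a))"
      by (metis isomorphic_def empty_iff)
    then have "isomorphic (contract G (edge_image \<psi> a)) G'"
      using a isomorphic_trans[OF K(2,1) isomorphic_sym[OF K]] by (simp add: contracting_edges_def)
    with b show ?thesis by (simp add: contracting_edges_def)
  qed
  moreover have "finite ?C"
    using finite_subset[OF C finite_edges[OF G]] .
  ultimately show ?thesis
    using inj endo_inj_surj[of ?C "edge_image \<psi>"] by (auto simp: bij_betw_def)
qed

context graph_local_system
begin

text \<open>Automorphisms of \<open>G\<close> permute the contracting edges, and with them the summands.\<close>

lemma block_diff_closed:
  assumes G: "G \<in> A" "G \<in> Grph g" and G': "G' \<in> A" "G' \<in> Grph g"
    and \<phi>: "\<And>a. a \<in> contracting_edges G G' \<Longrightarrow> \<phi> a \<in> isos (contract G a) G'"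
    and x: "x \<in> invariants scale V VM G'"
  shows "block_diff scale V VM G G' \<phi> x \<in> invariants scale V VM G"
proof -
  let ?C = "contracting_edges G G'" and ?d = "\<lambda>a. edge_diff scale V VM G G' a (\<phi> a) x"
  have mg: "multigraph G" using G by (simp add: Grph_def)
  have C: "a \<in> nonloop_edges G" if "a \<in> ?C" for a
    using that by (simp add: contracting_edges_def)
  have xt: "x \<in> twisted scale V G'" using x by (simp add: invariants_def)
  have "?d a \<in> twisted scale V G" if "a \<in> ?C" for a
    using bij_betw_apply[OF bij_betw_edge_diff[OF G G' C[OF that] \<phi>[OF that]] xt] .
  then have "block_diff scale V VM G G' \<phi> x \<in> twisted scale V G"
    unfolding block_diff_def by (intro pscale.subspace_sum subspace_twisted)
  moreover have "act G \<psi> (block_diff scale V VM G G' \<phi> x) = block_diff scale V VM G G' \<phi> x"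
    if \<psi>: "\<psi> \<in> isos G G" for \<psi>
  proof -
    interpret act: module_hom pscale pscale "act G \<psi>" by (rule module_hom_tensor_map)
    have bij: "bij_betw (edge_image \<psi>) ?C ?C"
      by (rule bij_betw_contracting_edges[OF mg \<psi>])
    have "(\<Sum>a\<in>?C. ?d a) = (\<Sum>a\<in>?C. ?d (edge_image \<psi> a))"
      using sum.reindex_bij_betw[OF bij, of ?d] by simp
    then have "act G \<psi> (\<Sum>a\<in>?C. ?d a) = act G \<psi> (\<Sum>a\<in>?C. ?d (edge_image \<psi> a))"
      by (rule arg_cong)
    also have "\<dots> = (\<Sum>a\<in>?C. act G \<psi> (?d (edge_image \<psi> a)))"
      by (rule act.sum)
    also have "\<dots> = (\<Sum>a\<in>?C. ?d a)"
    proof (rule sum.cong[OF refl])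
      fix a assume a: "a \<in> ?C"
      show "act G \<psi> (?d (edge_image \<psi> a)) = ?d a"
        by (rule edge_diff_equivariant_invariants[OF G G' C[OF a] \<psi> \<phi>[OF a]
              \<phi>[OF bij_betw_apply[OF bij a]] x])
    qed
    finally show ?thesis by (simp add: block_diff_def)
  qed
  ultimately show ?thesis by (simp add: invariants_def)
qed

lemma inj_on_block_diff:
  assumes G: "G \<in> A" "G \<in> Grph g" and G': "G' \<in> A" "G' \<in> Grph g"
    and C: "contracting_edges G G' = {e}" and f: "\<phi> e \<in> isos (contract G e) G'"
  shows "inj_on (block_diff scale V VM G G' \<phi>) (invariants scale V VM G')"
proof -
  have "e \<in> nonloop_edges G" using C by (auto simp: contracting_edges_def)
  from bij_betw_edge_diff[OF G G' this f]
  have "inj_on (edge_diff scale V VM G G' e (\<phi> e)) (invariants scale V VM G')"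
    by (auto simp: bij_betw_def invariants_def intro: inj_on_subset)
  then show ?thesis
    by (simp add: inj_on_def block_diff_def C)
qed

text \<open>The preimage of \<open>y\<close> under the single summand at \<open>e\<close> is invariant, because every automorphism of \<open>G'\<close>
  comes from one of \<open>G\<close> fixing \<open>e\<close>, under which \<open>y\<close> is invariant.  By transitivity all other summands
  take the same value \<open>y\<close> on it, so it remains to divide by the number of edges.\<close>

lemma block_diff_surj:
  assumes G: "G \<in> A" "G \<in> Grph g" and G': "G' \<in> A" "G' \<in> Grph g"
    and e: "e \<in> nonloop_edges G" and \<theta>: "\<theta> \<in> isos (contract G e) G'"
    and \<phi>: "\<And>a. a \<in> contracting_edges G G' \<Longrightarrow> \<phi> a \<in> isos (contract G a) G'"
    and trans: "\<And>a. a \<in> contracting_edges G G' \<Longrightarrow> \<exists>\<psi>\<in>isos G G. edge_image \<psi> a = e"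
    and surj: "induced_aut G G' e \<theta> ` stab G e = isos G' G'"
    and y: "y \<in> invariants scale V VM G"
  shows "y \<in> block_diff scale V VM G G' \<phi> ` invariants scale V VM G'"
proof -
  let ?C = "contracting_edges G G'" and ?T = "edge_diff scale V VM G G' e \<theta>"
  have mg: "multigraph G" "multigraph G'" using G G' by (auto simp: Grph_def)
  have ee: "e \<in> edges G" using e nonloop_edges_subset by blast
  have bij: "bij_betw ?T (twisted scale V G') (twisted scale V G)"
    by (rule bij_betw_edge_diff[OF G G' e \<theta>])
  have yt: "y \<in> twisted scale V G" and y_inv: "\<And>\<psi>. \<psi> \<in> isos G G \<Longrightarrow> act G \<psi> y = y"
    using y by (auto simp: invariants_def)
  obtain x where xt: "x \<in> twisted scale V G'" and Tx: "?T x = y"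
    using bij yt by (metis bij_betw_imp_surj_on imageE)
  have "act G' \<eta> x = x" if \<eta>: "\<eta> \<in> isos G' G'" for \<eta>
  proof -
    obtain \<psi> where \<psi>: "\<psi> \<in> stab G e" "\<eta> = induced_aut G G' e \<theta> \<psi>"
      using surj \<eta> by blast
    then have \<psi>i: "\<psi> \<in> isos G G" "edge_image \<psi> e = e" by (auto simp: stab_def)
    have "act G \<psi> (?T x) = ?T (act G' \<eta> x)"
      using edge_diff_equivariant[OF G G' e \<psi>i(1) \<eta> \<theta>, of \<theta>] induced_aut(2)[OF mg ee \<theta> \<psi>(1)]
        \<psi>i(2) \<theta> xt \<psi>(2) by simp
    then have "?T (act G' \<eta> x) = ?T x"
      using y_inv[OF \<psi>i(1)] Tx by simp
    then show ?thesis
      using bij act_closed[OF G' \<eta> xt] xt by (auto simp: bij_betw_def inj_on_eq_iff)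
  qed
  with xt have x: "x \<in> invariants scale V VM G'" by (simp add: invariants_def)
  have "edge_diff scale V VM G G' a (\<phi> a) x = y" if a: "a \<in> ?C" for a
  proof -
    obtain \<psi> where \<psi>: "\<psi> \<in> isos G G" "edge_image \<psi> a = e" using trans[OF a] by blast
    have "a \<in> nonloop_edges G" using a by (simp add: contracting_edges_def)
    from edge_diff_equivariant_invariants[OF G G' this \<psi>(1) \<phi>[OF a] _ x, of \<theta>] \<theta> \<psi>
    show ?thesis using Tx y_inv by simp
  qed
  then have "block_diff scale V VM G G' \<phi> x = (\<Sum>a\<in>?C. y)"
    unfolding block_diff_def by (intro sum.cong) auto
  then have dx: "block_diff scale V VM G G' \<phi> x = pscale (of_nat (card ?C)) y"
    by (simp only: pscale.sum_constant_scale)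
  have "finite ?C"
    using finite_edges[OF mg(1)] nonloop_edges_subset[of G]
    by (auto simp: contracting_edges_def intro: finite_subset)
  moreover have "e \<in> ?C" using e \<theta> by (auto simp: contracting_edges_def isomorphic_def)
  ultimately have n: "rat_of_nat (card ?C) \<noteq> 0" by auto
  let ?x = "pscale (1 / rat_of_nat (card ?C)) x"
  have scale: "edge_diff scale V VM G G' a f (pscale c z) = pscale c (edge_diff scale V VM G G' a f z)"
    for a f c z
    unfolding edge_diff_def by (rule module_hom.scale[OF module_hom_tensor_map])
  have "block_diff scale V VM G G' \<phi> ?x = y"
    using dx n by (simp add: block_diff_def scale flip: pscale.scale_sum_right)
  moreover have "?x \<in> invariants scale V VM G'"
    using x pscale.subspace_scale[OF subspace_twisted]
    by (auto simp: invariants_def module_hom.scale[OF module_hom_tensor_map])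
  ultimately show ?thesis by blast
qed

end

theorem propositionA3:
  fixes g :: nat
    and A :: "('v, 'h) mgraph set"
    and scale :: "rat \<Rightarrow> 'w::ab_group_add \<Rightarrow> 'w"
    and V :: "('v, 'h) mgraph \<Rightarrow> 'w set"
    and VM :: "('v, 'h) mgraph \<Rightarrow> ('v, 'h) mgraph \<Rightarrow> ('v + 'h \<Rightarrow> 'v + 'h) \<Rightarrow> 'w \<Rightarrow> 'w"
    and G G' :: "('v, 'h) mgraph"
    and e :: "'h set"
    and \<theta> :: "'v + 'h \<Rightarrow> 'v + 'h"
    and \<phi> :: "'h set \<Rightarrow> 'v + 'h \<Rightarrow> 'v + 'h"
  assumes "g \<ge> 1"
    and "full_subcategory g A"
    and "diamond_property A"
    and "graph_local_system scale g A V VM"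
    and "G \<in> A" and "G' \<in> A"
    and "e \<in> nonloop_edges G"
    and "\<theta> \<in> isos (contract G e) G'"
    and "\<And>a. a \<in> contracting_edges G G' \<Longrightarrow> \<phi> a \<in> isos (contract G a) G'"
  shows
    "(group_hom (stab_group G e) (Aut G) (\<lambda>\<psi>. \<psi>) \<and>
      inj_on (\<lambda>\<psi>. \<psi>) (carrier (stab_group G e)) \<and>
      group_hom (stab_group G e) (Aut G') (induced_aut G G' e \<theta>) \<and>
      inj_on (induced_aut G G' e \<theta>) (carrier (stab_group G e))) \<and>
     ((\<forall>e'\<in>nonloop_edges G. e' \<noteq> e \<longrightarrow> isomorphic (contract G e') (contract G e) \<longrightarrow>
         (\<exists>\<psi>\<in>carrier (Aut G). edge_image \<psi> e' = e)) \<longrightarrow>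
      (stab G e = carrier (Aut G) \<longrightarrow>
         inj_on (block_diff scale V VM G G' \<phi>) (invariants scale V VM G')) \<and>
      (induced_aut G G' e \<theta> ` carrier (stab_group G e) = carrier (Aut G') \<and> stab G e \<lhd> Aut G \<longrightarrow>
         block_diff scale V VM G G' \<phi> ` invariants scale V VM G' = invariants scale V VM G))"
proof -
  interpret graph_local_system scale g A V VM by fact
  let ?C = "contracting_edges G G'"
  have G: "G \<in> A" "G \<in> Grph g" and G': "G' \<in> A" "G' \<in> Grph g"
    using assms(2,5,6) by (auto simp: full_subcategory_def)
  have mg: "multigraph G" "multigraph G'" using G G' by (auto simp: Grph_def)
  note e = assms(7) and \<theta> = assms(8) and \<phi> = assms(9)
  have ee: "e \<in> edges G" using e nonloop_edges_subset by blast
  have eC: "e \<in> ?C" using e \<theta> by (auto simp: contracting_edges_def isomorphic_def)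
  have "group_hom (stab_group G e) (Aut G) (\<lambda>\<psi>. \<psi>)"
    using group_stab_group[OF mg(1) ee] group_Aut[OF mg(1)]
    by (auto simp: group_hom_def group_hom_axioms_def hom_def mult_stab_group stab_def)
  moreover have "group_hom (stab_group G e) (Aut G') (induced_aut G G' e \<theta>)"
    by (rule group_hom_induced_aut[OF mg ee \<theta>])
  moreover have "inj_on (induced_aut G G' e \<theta>) (stab G e)"
    by (rule inj_on_induced_aut[OF G(2) assms(1) mg(2) e \<theta>])
  moreover have "inj_on (block_diff scale V VM G G' \<phi>) (invariants scale V VM G')"
    if trans: "\<And>a. a \<in> ?C \<Longrightarrow> \<exists>\<psi>\<in>isos G G. edge_image \<psi> a = e" and stab: "stab G e = isos G G"
  proof (rule inj_on_block_diff[where e = e, OF G G'])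
    show "\<phi> e \<in> isos (contract G e) G'" by (rule \<phi>[OF eC])
    have "a = e" if a: "a \<in> ?C" for a
    proof -
      obtain \<psi> where \<psi>: "\<psi> \<in> isos G G" "edge_image \<psi> a = e" using trans[OF a] by blast
      then have "edge_image \<psi> e = e" using stab by (auto simp: stab_def)
      moreover have "a \<in> edges G" using a nonloop_edges_subset by (auto simp: contracting_edges_def)
      ultimately show ?thesis
        using isos_bij_edges(1)[OF mg(1) \<psi>(1)] \<psi>(2) ee by (metis bij_betw_def inj_onD)
    qed
    with eC show "?C = {e}" by blast
  qed
  moreover have "block_diff scale V VM G G' \<phi> ` invariants scale V VM G' = invariants scale V VM G"
    if trans: "\<And>a. a \<in> ?C \<Longrightarrow> \<exists>\<psi>\<in>isos G G. edge_image \<psi> a = e"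
      and surj: "induced_aut G G' e \<theta> ` stab G e = isos G' G'"
    using block_diff_closed[OF G G' \<phi>] block_diff_surj[OF G G' e \<theta> \<phi> trans surj] by blast
  moreover have "\<exists>\<psi>\<in>isos G G. edge_image \<psi> a = e"
    if hyp: "\<forall>e'\<in>nonloop_edges G. e' \<noteq> e \<longrightarrow> isomorphic (contract G e') (contract G e) \<longrightarrow>
        (\<exists>\<psi>\<in>carrier (Aut G). edge_image \<psi> e' = e)" and a: "a \<in> ?C" for a
  proof (cases "a = e")
    case True
    then show ?thesis
      using id_in_isos[OF mg(1)] edge_image_id[OF edges_subset[OF mg(1) ee]] by blast
  next
    case False
    have an: "a \<in> nonloop_edges G" and iso: "isomorphic (contract G a) G'"
      using a by (auto simp: contracting_edges_def)
    have K: "multigraph (contract G a)" "multigraph (contract G e)"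
      using multigraph_contract[OF mg(1)] an ee nonloop_edges_subset by blast+
    have "isomorphic (contract G a) (contract G e)"
      using isomorphic_trans[OF K(1) mg(2) iso] isomorphic_sym[OF K(2) mg(2)] \<theta>
      by (auto simp: isomorphic_def)
    with hyp an False show ?thesis by simp
  qed
  ultimately show ?thesis by auto
qed

end
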